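(* Let $E$ be an ordered Banach space whose positive cone $K$ is normal, let $\omega>0$ and $\tau>0$, let $A:D(A)\subset E\to E$ be a closed linear operator such that $-A$ generates a positive equicontinuous $C_0$-semigroup $T(t)$ $(t\ge 0)$ on $E$, and let $F:\mathbb{R}\times E\times E\to E$ be a continuous mapping which is $\omega$-periodic in $t$. Assume that the delayed evolution equation $$u'(t)+Au(t)=F(t,u(t),u(t-\tau)),\qquad t\in\mathbb{R},$$ has an $\omega$-periodic lower solution $v_0$ and an $\omega$-periodic upper solution $w_0$, $v_0,w_0\in C^1_\omega(\mathbb{R},E)\cap C_\omega(\mathbb{R},E_1)$, with $v_0\le w_0$. Suppose: (i) there exists a constant $C\ge0$ such that for all $t\in\mathbb{R}$ and all $x_1,x_2,y_1,y_2\in E$ with $v_0(t)\le x_1\le x_2\le w_0(t)$ and $v_0(t-\tau)\le y_1\le y_2\le w_0(t-\tau)$, $$F(t,x_2,y_2)-F(t,x_1,y_1)\ge -C(x_2-x_1);$$ (ii) there exists a constant $c\in\left[0,\frac{1}{4\omega C_SM_S}\right)$ such that for all $t\in\mathbb{R}$ and all monotonic sequences $\{u_n\}\subset[v_0,w_0]$, $$\alpha(\{F(t,u_n(t),u_n(t-\tau))+Cu_n(t)\})\le c\big(\alpha(\{u_n(t)\})+\alpha(\{u_n(t-\tau)\})\big),$$ where $S(t)=e^{-Ct}T(t)$ $(t\ge0)$, $C_S=\|(I-S(\omega))^{-1}\|$ and $M_S=\sup\{\|S(t)\|: t\ge0\}$. Then the equation has a minimal $\omega$-periodic mild solution $\underline{u}$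 and a maximal $\omega$-periodic mild solution $\overline{u}$ between $v_0$ and $w_0$, and these can be obtained by monotone iterative sequences starting from $v_0$ and $w_0$, respectively.
   Context: The cone is $K=\{u\in E: u\ge\theta\}$, $\theta$ the zero element; normal with constant $N$ means $\theta\le x\le y$ implies $\|x\|\le N\|y\|$. $C_\omega(\mathbb{R},E)$ is the Banach space of continuous $\omega$-periodic functions $u:\mathbb{R}\to E$ with norm $\|u\|_C=\max_{t\in[0,\omega]}\|u(t)\|$, ordered pointwise. $C^1_\omega(\mathbb{R},E)$ is the set of $C^1$ functions in $C_\omega(\mathbb{R},E)$. $E_1=D(A)$ with the graph norm $\|\cdot\|+\|A\cdot\|$, and $C_\omega(\mathbb{R},E_1)$ is the corresponding space of continuous $\omega$-periodic $E_1$-valued functions. $[v_0,w_0]=\{u\in C(\mathbb{R},E): v_0(t)\le u(t)\le w_0(t)\ \forall t\in\mathbb{R}\}$; a sequence in it is monotonic if it is increasing or decreasing for the pointwise order. $\alpha$ is the Kuratowski measure of noncompactness of bounded subsets of $E$. A $C_0$-semigroup $T(t)$ is positive if $T(t)x\ge\theta$ for all $x\ge\theta$, $t\ge0$; it is equicontinuous if $t\mapsto T(t)$ is continuous in the operator norm for $t>0$. $S(t)=e^{-Ct}T(t)$ is the positive $C_0$-semigroup generated by $-(A+CI)$. A function $v_0\in C^1_\omega(\mathbb{R},E)\cap C_\omega(\mathbb{R},E_1)$ is an $\omega$-periodic lower solution if $v_0'(t)+Av_0(t)\le F(t,v_0(t),v_0(t-\tau))$ for all $t\in\mathbb{R}$;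 an $\omega$-periodic upper solution is defined with the inequality reversed. An $\omega$-periodic mild solution is $u\in C_\omega(\mathbb{R},E)$ with $u(t)=T(t-s)u(s)+\int_s^tT(t-r)F(r,u(r),u(r-\tau))\,dr$ for all $s\le t$. Minimal and maximal between $v_0$ and $w_0$ means: $v_0\le\underline{u}\le\overline{u}\le w_0$, and every $\omega$-periodic mild solution $u$ with $v_0\le u\le w_0$ satisfies $\underline{u}\le u\le\overline{u}$. Monotone iterative sequences: put $$(Qu)(t)=(I-S(\omega))^{-1}\int_{t-\omega}^tS(t-s)\big(F(s,u(s),u(s-\tau))+Cu(s)\big)\,ds .$$ The sequences are $v_i=Qv_{i-1}$, $w_i=Qw_{i-1}$ $(i\ge1)$; they satisfy $v_0\le v_1\le\cdots\le v_i\le\cdots\le w_i\le\cdots\le w_1\le w_0$, and "obtained" means $v_i\to\underline{u}$, $w_i\to\overline{u}$ in $C_\omega(\mathbb{R},E)$. *)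

theory Defs
  imports "HOL-Analysis.Analysis"
begin

section \<open>Ordered Banach spaces\<close>

text \<open>The positive cone of an ordered Banach space is a \<^emph>\<open>closed\<close> convex cone with
  \<open>K \<inter> (- K) = {0}\<close>; everything but closedness is part of \<^class>\<open>ordered_real_vector\<close>.\<close>

class ordered_banach = banach + ordered_real_vector +
  assumes closed_nonneg_cone: "closed {x. 0 \<le> x}"

definition normal_cone :: "'a::ordered_banach itself \<Rightarrow> bool" where
  "normal_cone _ \<longleftrightarrow> (\<exists>N. \<forall>x y::'a. 0 \<le> x \<and> x \<le> y \<longrightarrow> norm x \<le> N * norm y)"


section \<open>Unbounded operators and semigroups\<close>

text \<open>A partial operator is a total function \<open>A\<close> together with its domain \<open>D\<close>; the values
  of \<open>A\<close> outside \<open>D\<close> are never used. Likewise a semigroup is only looked at on \<open>t \<ge> 0\<close>.\<close>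

definition closed_linear_op :: "'a::real_normed_vector set \<Rightarrow> ('a \<Rightarrow> 'a) \<Rightarrow> bool" where
  "closed_linear_op D A \<longleftrightarrow> subspace D
     \<and> (\<forall>x\<in>D. \<forall>y\<in>D. A (x + y) = A x + A y)
     \<and> (\<forall>r. \<forall>x\<in>D. A (r *\<^sub>R x) = r *\<^sub>R A x)
     \<and> closed ((\<lambda>x. (x, A x)) ` D)"

definition C0_semigroup :: "(real \<Rightarrow> 'a::real_normed_vector \<Rightarrow>\<^sub>L 'a) \<Rightarrow> bool" where
  "C0_semigroup T \<longleftrightarrow> T 0 = id_blinfun
     \<and> (\<forall>s\<ge>0. \<forall>t\<ge>0. T (s + t) = T s o\<^sub>L T t)
     \<and> (\<forall>x. continuous_on {0..} (\<lambda>t. blinfun_apply (T t) x))"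

text \<open>\<open>B\<close> with domain \<open>D\<close> is the infinitesimal generator of \<open>T\<close>: \<open>x\<close> lies in \<open>D\<close> exactly
  when the right derivative of \<open>T(h)x\<close> at \<open>0\<close> exists, and that derivative is \<open>B x\<close>.\<close>

definition generator_of :: "'a::real_normed_vector set \<Rightarrow> ('a \<Rightarrow> 'a) \<Rightarrow> (real \<Rightarrow> 'a \<Rightarrow>\<^sub>L 'a) \<Rightarrow> bool" where
  "generator_of D B T \<longleftrightarrow>
     (\<forall>x y. x \<in> D \<and> B x = y \<longleftrightarrow>
        ((\<lambda>h. (blinfun_apply (T h) x - x) /\<^sub>R h) \<longlongrightarrow> y) (at_right 0))"

definition positive_semigroup :: "(real \<Rightarrow> 'a::ordered_banach \<Rightarrow>\<^sub>L 'a) \<Rightarrow> bool" where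
  "positive_semigroup T \<longleftrightarrow> (\<forall>t\<ge>0. \<forall>x\<ge>0. 0 \<le> blinfun_apply (T t) x)"

definition equicontinuous_semigroup :: "(real \<Rightarrow> 'a::real_normed_vector \<Rightarrow>\<^sub>L 'a) \<Rightarrow> bool" where
  "equicontinuous_semigroup T \<longleftrightarrow> continuous_on {0<..} T"

definition shifted_semigroup :: "real \<Rightarrow> (real \<Rightarrow> 'a::real_normed_vector \<Rightarrow>\<^sub>L 'a) \<Rightarrow> real \<Rightarrow> 'a \<Rightarrow>\<^sub>L 'a" where
  "shifted_semigroup C T t = exp (- C * t) *\<^sub>R T t"

definition is_blinfun_inverse :: "('a::real_normed_vector \<Rightarrow>\<^sub>L 'a) \<Rightarrow> ('a \<Rightarrow>\<^sub>L 'a) \<Rightarrow> bool" where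
  "is_blinfun_inverse L R \<longleftrightarrow> R o\<^sub>L L = id_blinfun \<and> L o\<^sub>L R = id_blinfun"

definition blinfun_invertible :: "('a::real_normed_vector \<Rightarrow>\<^sub>L 'a) \<Rightarrow> bool" where
  "blinfun_invertible L \<longleftrightarrow> (\<exists>R. is_blinfun_inverse L R)"

definition blinfun_inv :: "('a::real_normed_vector \<Rightarrow>\<^sub>L 'a) \<Rightarrow> 'a \<Rightarrow>\<^sub>L 'a" where
  "blinfun_inv L = (THE R. is_blinfun_inverse L R)"

definition C_S :: "real \<Rightarrow> (real \<Rightarrow> 'a::real_normed_vector \<Rightarrow>\<^sub>L 'a) \<Rightarrow> real" where
  "C_S \<omega> S = norm (blinfun_inv (id_blinfun - S \<omega>))"

text \<open>Meaningful only when the set of norms is bounded above.\<close>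

definition M_S :: "(real \<Rightarrow> 'a::real_normed_vector \<Rightarrow>\<^sub>L 'a) \<Rightarrow> real" where
  "M_S S = (SUP t\<in>{0..}. norm (S t))"


section \<open>Kuratowski measure of noncompactness\<close>

text \<open>Meaningful for bounded \<open>B\<close>. The covering sets are required to be bounded because
  \<^const>\<open>diameter\<close> is unspecified on unbounded sets.\<close>

definition kuratowski :: "'a::metric_space set \<Rightarrow> real" where
  "kuratowski B = Inf {d. 0 < d \<and> (\<exists>\<C>. finite \<C> \<and> B \<subseteq> \<Union>\<C> \<and> (\<forall>X\<in>\<C>. bounded X \<and> diameter X \<le> d))}"


section \<open>Spaces of periodic functions\<close>

definition C_per :: "real \<Rightarrow> (real \<Rightarrow> 'a::topological_space) set" where
  "C_per \<omega> = {u. continuous_on UNIV u \<and> (\<forall>t. u (t + \<omega>) = u t)}"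

definition C1_per :: "real \<Rightarrow> (real \<Rightarrow> 'a::real_normed_vector) set" where
  "C1_per \<omega> = {u \<in> C_per \<omega>. u C1_differentiable_on UNIV}"

definition graph_norm :: "('a::real_normed_vector \<Rightarrow> 'a) \<Rightarrow> 'a \<Rightarrow> real" where
  "graph_norm A x = norm x + norm (A x)"

text \<open>Periodic functions into \<open>D(A)\<close>, continuous for the graph norm.\<close>

definition C_per_graph :: "real \<Rightarrow> 'a::real_normed_vector set \<Rightarrow> ('a \<Rightarrow> 'a) \<Rightarrow> (real \<Rightarrow> 'a) set" where
  "C_per_graph \<omega> D A = {u. (\<forall>t. u t \<in> D) \<and> (\<forall>t. u (t + \<omega>) = u t)
     \<and> (\<forall>t. ((\<lambda>s. graph_norm A (u s - u t)) \<longlongrightarrow> 0) (at t))}"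

definition C_per_norm :: "real \<Rightarrow> (real \<Rightarrow> 'a::real_normed_vector) \<Rightarrow> real" where
  "C_per_norm \<omega> u = (SUP t\<in>{0..\<omega>}. norm (u t))"

definition converges_in_C_per :: "real \<Rightarrow> (nat \<Rightarrow> real \<Rightarrow> 'a::real_normed_vector) \<Rightarrow> (real \<Rightarrow> 'a) \<Rightarrow> bool" where
  "converges_in_C_per \<omega> v u \<longleftrightarrow> (\<forall>i. v i \<in> C_per \<omega>) \<and> u \<in> C_per \<omega>
     \<and> (\<lambda>i. C_per_norm \<omega> (\<lambda>t. v i t - u t)) \<longlonglongrightarrow> 0"

text \<open>The order interval consists of continuous functions that need not be periodic.\<close>

definition order_interval :: "(real \<Rightarrow> 'a::ordered_banach) \<Rightarrow> (real \<Rightarrow> 'a) \<Rightarrow> (real \<Rightarrow> 'a) set" where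
  "order_interval v w = {u. continuous_on UNIV u \<and> (\<forall>t. v t \<le> u t \<and> u t \<le> w t)}"


section \<open>The delayed evolution equation\<close>

definition lower_solution ::
  "real \<Rightarrow> real \<Rightarrow> 'a::ordered_banach set \<Rightarrow> ('a \<Rightarrow> 'a) \<Rightarrow> (real \<Rightarrow> 'a \<Rightarrow> 'a \<Rightarrow> 'a) \<Rightarrow> (real \<Rightarrow> 'a) \<Rightarrow> bool" where
  "lower_solution \<omega> \<tau> D A F v \<longleftrightarrow> v \<in> C1_per \<omega> \<inter> C_per_graph \<omega> D A
     \<and> (\<forall>t. vector_derivative v (at t) + A (v t) \<le> F t (v t) (v (t - \<tau>)))"

definition upper_solution ::
  "real \<Rightarrow> real \<Rightarrow> 'a::ordered_banach set \<Rightarrow> ('a \<Rightarrow> 'a) \<Rightarrow> (real \<Rightarrow> 'a \<Rightarrow> 'a \<Rightarrow> 'a) \<Rightarrow> (real \<Rightarrow> 'a) \<Rightarrow> bool" where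
  "upper_solution \<omega> \<tau> D A F w \<longleftrightarrow> w \<in> C1_per \<omega> \<inter> C_per_graph \<omega> D A
     \<and> (\<forall>t. F t (w t) (w (t - \<tau>)) \<le> vector_derivative w (at t) + A (w t))"

definition mild_solution ::
  "real \<Rightarrow> real \<Rightarrow> (real \<Rightarrow> 'a::banach \<Rightarrow>\<^sub>L 'a) \<Rightarrow> (real \<Rightarrow> 'a \<Rightarrow> 'a \<Rightarrow> 'a) \<Rightarrow> (real \<Rightarrow> 'a) \<Rightarrow> bool" where
  "mild_solution \<omega> \<tau> T F u \<longleftrightarrow> u \<in> C_per \<omega>
     \<and> (\<forall>s t. s \<le> t \<longrightarrow>
          u t = blinfun_apply (T (t - s)) (u s)
              + integral {s..t} (\<lambda>r. blinfun_apply (T (t - r)) (F r (u r) (u (r - \<tau>)))))"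

definition iter_op ::
  "real \<Rightarrow> real \<Rightarrow> real \<Rightarrow> (real \<Rightarrow> 'a::banach \<Rightarrow>\<^sub>L 'a) \<Rightarrow> (real \<Rightarrow> 'a \<Rightarrow> 'a \<Rightarrow> 'a) \<Rightarrow> (real \<Rightarrow> 'a) \<Rightarrow> real \<Rightarrow> 'a" where
  "iter_op \<omega> \<tau> C T F u t =
     (let S = shifted_semigroup C T in
      blinfun_apply (blinfun_inv (id_blinfun - S \<omega>))
        (integral {t - \<omega>..t}
          (\<lambda>s. blinfun_apply (S (t - s)) (F s (u s) (u (s - \<tau>)) + C *\<^sub>R u s))))"

end

theory Submission
  imports Defs "HOL-Library.Periodic_Fun"
begin

text \<open>The equation is rewritten for \<open>S\<close> with nonlinearity \<open>F + C u\<close>, which is increasing between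
  \<open>v\<^sub>0\<close> and \<open>w\<^sub>0\<close>; periodic mild solutions are the fixed points of \<open>Q\<close>. Although \<open>S(\<omega>)\<close> may have
  spectral radius \<open>1\<close>, its powers are bounded, and this already makes \<open>(I - S(\<omega>))\<^sup>-\<^sup>1\<close>
  positive, so \<open>Q\<close> is increasing and the iterates are monotone. If \<open>\<Phi>\<close> is the supremum
  over \<open>t\<close> of the measures of noncompactness of the orbits \<open>{v\<^sub>i(t)}\<close>, then Heinz' inequality
  \<open>\<alpha>({\<integral>g\<^sub>n}) \<le> 2 \<integral>\<alpha>({g\<^sub>n})\<close> and (ii) give \<open>\<Phi> \<le> 4 \<omega> C\<^sub>S M\<^sub>S c \<Phi>\<close>, hence \<open>\<Phi> = 0\<close>. Monotone sequences
  with relatively compact range converge because the cone is normal.\<close>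

section \<open>Order and integration\<close>

text \<open>Comparison takes place among mild solutions. A lower solution \<open>v0\<close> solves
  the linear equation exactly for the right-hand side \<open>v0' + A v0 + C v0\<close>, which lies
  below \<open>F + C v0\<close>; since the linear periodic solution operator is increasing,
  \<open>v0 \<le> Q v0\<close>, and dually for \<open>w0\<close>. The generator supplies derivatives
  from the right only, which is why a one-sided calculus is set up.

  In \<open>4 * \<omega> * C_S * M_S\<close>, one factor 2 is that of Heinz and the other comes from
  (ii), where the undelayed and the delayed orbit each contribute at most \<open>\<Phi>\<close>; the
  window of length \<open>\<omega>\<close>, the bound of \<open>S\<close> and the inverse of
  \<open>I - S(\<omega>)\<close> give the rest. The supremum over all \<open>t\<close> treats both
  orbits alike and puts a constant under the integral in Heinz' inequality, so measurability of the
  measures of noncompactness in \<open>t\<close> never comes up.\<close>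

lemma le_epsilon_mult:
  fixes x y K :: real
  assumes "\<And>e. e > 0 \<Longrightarrow> x \<le> y + e * K" "K \<ge> 0"
  shows "x \<le> y"
proof (rule field_le_epsilon)
  fix e :: real assume e: "e > 0"
  have "x \<le> y + e / (K + 1) * K"
    using assms(1)[of "e / (K + 1)"] assms(2) e by simp
  also have "e / (K + 1) * K \<le> e"
    using assms(2) e by (simp add: field_simps)
  finally show "x \<le> y + e" by simp
qed

text \<open>Closedness of the cone, applied to the differences \<open>g i - f i\<close>, replaces an
  order topology: the order is partial and is tied to the norm through the cone alone.\<close>

lemma tendsto_le_ordered_banach:
  fixes x y :: "'a::ordered_banach"
  assumes "(f \<longlongrightarrow> x) G" "(g \<longlongrightarrow> y) G" "G \<noteq> bot" "eventually (\<lambda>i. f i \<le> g i) G"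
  shows "x \<le> y"
proof -
  have "y - x \<in> {z. 0 \<le> z}"
  proof (rule Lim_in_closed_set[OF closed_nonneg_cone])
    show "eventually (\<lambda>i. g i - f i \<in> {z. 0 \<le> z}) G"
      using assms(4) by eventually_elim simp
    show "((\<lambda>i. g i - f i) \<longlongrightarrow> y - x) G"
      by (intro tendsto_diff assms)
  qed (fact assms)
  then show ?thesis by simp
qed

text \<open>Riemann sums of \<open>f\<close> are nonnegative combinations of its values, hence lie
  in the cone; they approximate \<open>y\<close>, and the cone is closed.\<close>

lemma has_integral_nonneg_cone:
  fixes f :: "real \<Rightarrow> 'a::ordered_banach"
  assumes f: "(f has_integral y) {a..b}" and nonneg: "\<And>x. x \<in> {a..b} \<Longrightarrow> 0 \<le> f x"
  shows "0 \<le> y"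
proof -
  have "y \<in> closure {z::'a. 0 \<le> z}"
    unfolding closure_approachable
  proof (intro allI impI)
    fix e :: real assume "e > 0"
    with f obtain d where d: "gauge d"
      "\<And>p. p tagged_division_of cbox a b \<Longrightarrow> d fine p \<Longrightarrow>
         norm ((\<Sum>(x, k)\<in>p. measure lborel k *\<^sub>R f x) - y) < e"
      unfolding box_real(2)[symmetric] has_integral by metis
    obtain p where p: "p tagged_division_of cbox a b" "d fine p"
      using fine_division_exists[OF d(1)] by blast
    have "0 \<le> (\<Sum>(x, k)\<in>p. measure lborel k *\<^sub>R f x)"
    proof (intro sum_nonneg, clarify)
      fix x k assume "(x, k) \<in> p"
      then have "x \<in> {a..b}"
        using tagged_division_ofD(2,3)[OF p(1)] unfolding box_real(2) by blast
      then show "0 \<le> measure lborel k *\<^sub>R f x"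
        using nonneg[of x] by (intro scaleR_nonneg_nonneg) auto
    qed
    then show "\<exists>z\<in>{z. 0 \<le> z}. dist z y < e"
      using d(2)[OF p] by (auto simp: dist_norm)
  qed
  also have "closure {z::'a. 0 \<le> z} = {z. 0 \<le> z}"
    by (rule closure_closed[OF closed_nonneg_cone])
  finally show ?thesis by simp
qed

lemma integral_mono_ordered_banach:
  fixes f g :: "real \<Rightarrow> 'a::ordered_banach"
  assumes "continuous_on {a..b} f" "continuous_on {a..b} g"
    and "\<And>x. x \<in> {a..b} \<Longrightarrow> f x \<le> g x"
  shows "integral {a..b} f \<le> integral {a..b} g"
proof -
  have "((\<lambda>x. g x - f x) has_integral (integral {a..b} g - integral {a..b} f)) {a..b}"
    using assms by (intro has_integral_diff integrable_integral integrable_continuous_real)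
  from has_integral_nonneg_cone[OF this] assms(3) show ?thesis by simp
qed

text \<open>The generator of a semigroup only yields one-sided derivatives, hence this form of the
  mean value inequality; the bound holds up to a largest point, which must be \<open>b\<close>.\<close>

lemma right_derivative_bound:
  fixes G :: "real \<Rightarrow> 'a::real_normed_vector"
  assumes ab: "a \<le> b" and cont: "continuous_on {a..b} G"
    and deriv: "\<And>s. s \<in> {a..<b} \<Longrightarrow> \<exists>d>0. \<forall>h. 0 < h \<and> h < d \<longrightarrow> norm (G (s + h) - G s) \<le> e * h"
  shows "norm (G b - G a) \<le> e * (b - a)"
proof -
  define X where "X = {s \<in> {a..b}. norm (G s - G a) \<le> e * (s - a)}"
  have "closed ({a..b} \<inter> (\<lambda>s. norm (G s - G a) - e * (s - a)) -` {..0})"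
    by (intro continuous_closed_preimage continuous_intros cont)
  moreover have "{a..b} \<inter> (\<lambda>s. norm (G s - G a) - e * (s - a)) -` {..0} = X"
    by (auto simp: X_def)
  ultimately have "closed X" by simp
  moreover have "bounded X"
    by (rule bounded_subset[of "{a..b}"]) (auto simp: X_def)
  ultimately have "compact X"
    by (simp add: compact_eq_bounded_closed)
  moreover have "a \<in> X"
    using ab by (simp add: X_def)
  ultimately obtain s where s: "s \<in> X" "\<And>r. r \<in> X \<Longrightarrow> r \<le> s"
    using compact_attains_sup[of X] by blast
  have "s = b"
  proof (rule ccontr)
    assume "s \<noteq> b"
    with s have sab: "s \<in> {a..<b}" by (auto simp: X_def)
    from deriv[OF this] obtain d where d: "d > 0"
      "\<And>h. 0 < h \<Longrightarrow> h < d \<Longrightarrow> norm (G (s + h) - G s) \<le> e * h" by blast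
    \<comment> \<open>Halving \<open>d\<close> gives the strict bound \<open>h < d\<close>; the cap
      \<open>b - s\<close> keeps \<open>s + h\<close> inside the interval.\<close>
    define h where "h = min (d / 2) (b - s)"
    have h: "0 < h" "h < d" "s + h \<le> b"
      using d sab by (auto simp: h_def)
    have "norm (G (s + h) - G a) \<le> norm (G (s + h) - G s) + norm (G s - G a)"
      using norm_triangle_ineq[of "G (s + h) - G s" "G s - G a"] by simp
    also have "\<dots> \<le> e * h + e * (s - a)"
      using d(2)[OF h(1,2)] s(1) by (intro add_mono) (auto simp: X_def)
    finally have "s + h \<in> X"
      using h sab by (auto simp: X_def algebra_simps)
    with s(2)[of "s + h"] h show False by simp
  qed
  with s show ?thesis by (simp add: X_def)
qed

text \<open>Subtracting the indefinite integral of \<open>f\<close> from \<open>g\<close> leaves a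
  continuous function whose right derivative vanishes. Half of \<open>e\<close> pays for the
  quotient of \<open>g\<close>, half for that of the integral, and the one-sided mean value
  inequality makes the difference constant.\<close>

lemma integral_right_derivative:
  fixes f g :: "real \<Rightarrow> 'a::banach"
  assumes ab: "a \<le> b" and contg: "continuous_on {a..b} g" and contf: "continuous_on {a..b} f"
    and deriv: "\<And>s. s \<in> {a..<b} \<Longrightarrow> ((\<lambda>h. (g (s + h) - g s) /\<^sub>R h) \<longlongrightarrow> f s) (at_right 0)"
  shows "integral {a..b} f = g b - g a"
proof -
  define G where "G s = g s - integral {a..s} f" for s
  have contG: "continuous_on {a..b} G"
    unfolding G_def using contf
    by (intro continuous_intros contg indefinite_integral_continuous_1 integrable_continuous_real)
  have "norm (G b - G a) \<le> 0"
  proof (rule le_epsilon_mult)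
    fix e :: real assume e: "e > 0"
    have "norm (G b - G a) \<le> e * (b - a)"
    proof (rule right_derivative_bound[OF ab contG])
      fix s assume s: "s \<in> {a..<b}"
      have "((\<lambda>u. integral {a..u} f) has_vector_derivative f s) (at s within {a..b})"
        using s by (intro integral_has_vector_derivative contf) auto
      then obtain d1 where d1: "d1 > 0" "\<And>r. r \<in> {a..b} \<Longrightarrow> norm (r - s) < d1 \<Longrightarrow>
          norm (integral {a..r} f - integral {a..s} f - (r - s) *\<^sub>R f s) \<le> (e/2) * norm (r - s)"
        unfolding has_vector_derivative_def has_derivative_within_alt
        using e by (metis half_gt_zero)
      from tendstoD[OF deriv[OF s], of "e/2"] e obtain d2 where d2: "d2 > 0"
        "\<And>h. 0 < h \<Longrightarrow> h < d2 \<Longrightarrow> dist ((g (s + h) - g s) /\<^sub>R h) (f s) < e/2"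
        unfolding eventually_at_right_field by auto
      show "\<exists>d>0. \<forall>h. 0 < h \<and> h < d \<longrightarrow> norm (G (s + h) - G s) \<le> e * h"
      proof (intro exI[of _ "min (min d1 d2) (b - s)"] conjI allI impI)
        show "0 < min (min d1 d2) (b - s)" using d1 d2 s by auto
        fix h assume "0 < h \<and> h < min (min d1 d2) (b - s)"
        then have h: "0 < h" "h < d1" "h < d2" "s + h \<in> {a..b}" using s by auto
        have "norm (integral {a..s + h} f - integral {a..s} f - h *\<^sub>R f s) \<le> (e/2) * h"
          using d1(2)[OF h(4)] h by simp
        moreover have "norm (g (s + h) - g s - h *\<^sub>R f s) \<le> (e/2) * h"
        proof -
          have "g (s + h) - g s - h *\<^sub>R f s = h *\<^sub>R ((g (s + h) - g s) /\<^sub>R h - f s)"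
            using h by (simp add: algebra_simps)
          also have "norm \<dots> \<le> h * (e/2)"
            using d2(2)[OF h(1,3)] h by (simp add: dist_norm)
          finally show ?thesis by (simp add: mult.commute)
        qed
        moreover have "G (s + h) - G s = (g (s + h) - g s - h *\<^sub>R f s)
            - (integral {a..s + h} f - integral {a..s} f - h *\<^sub>R f s)"
          by (simp add: G_def)
        ultimately show "norm (G (s + h) - G s) \<le> e * h"
          using norm_triangle_ineq4[of "g (s + h) - g s - h *\<^sub>R f s"
              "integral {a..s + h} f - integral {a..s} f - h *\<^sub>R f s"] by simp
      qed
    qed
    then show "norm (G b - G a) \<le> 0 + e * (b - a)" by simp
  qed (use ab in simp)
  then show ?thesis by (simp add: G_def algebra_simps)
qed

section \<open>The measure of noncompactness\<close>

text \<open>Together with \<open>kuratowski_cover\<close>, this trades diameters for pairwise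
  distances. The infimum runs over positive numbers only; \<open>d = 0\<close> is reached through
  \<open>d + e\<close>.\<close>

lemma kuratowski_le:
  fixes B :: "'a::real_normed_vector set"
  assumes "finite \<C>" "B \<subseteq> \<Union>\<C>" "0 \<le> d"
    and diam: "\<And>X x y. X \<in> \<C> \<Longrightarrow> x \<in> X \<Longrightarrow> y \<in> X \<Longrightarrow> norm (x - y) \<le> d"
  shows "kuratowski B \<le> d"
proof (rule field_le_epsilon)
  fix e :: real assume e: "e > 0"
  show "kuratowski B \<le> d + e"
    unfolding kuratowski_def
  proof (rule cInf_lower, rule CollectI, intro conjI exI[of _ \<C>] ballI)
    fix X assume X: "X \<in> \<C>"
    then show "bounded X"
      unfolding bounded_two_points dist_norm using diam by blast
    have "diameter X \<le> d"
      using diam[OF X] assms(3) by (intro diameter_le) auto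
    with e show "diameter X \<le> d + e" by simp
  qed (use assms e in \<open>auto intro!: bdd_belowI[of _ 0]\<close>)
qed

lemma kuratowski_cover:
  fixes B :: "'a::real_normed_vector set"
  assumes "bounded B" "kuratowski B < d"
  obtains \<C> where "finite \<C>" "B \<subseteq> \<Union>\<C>"
    "\<And>X x y. X \<in> \<C> \<Longrightarrow> x \<in> X \<Longrightarrow> y \<in> X \<Longrightarrow> norm (x - y) \<le> d"
proof -
  let ?D = "{d. 0 < d \<and> (\<exists>\<C>. finite \<C> \<and> B \<subseteq> \<Union>\<C> \<and> (\<forall>X\<in>\<C>. bounded X \<and> diameter X \<le> d))}"
  \<comment> \<open>The cover by \<open>B\<close> alone shows that the infimum is over a nonempty
    set; the summand 1 ensures positivity.\<close>
  have "\<bar>diameter B\<bar> + 1 \<in> ?D"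
    using assms(1) by (auto intro!: exI[of _ "{B}"])
  then have "?D \<noteq> {}" by blast
  from cInf_lessD[OF this, of d] assms(2) obtain r \<C> where r: "r < d" "finite \<C>" "B \<subseteq> \<Union>\<C>"
    "\<forall>X\<in>\<C>. bounded X \<and> diameter X \<le> r"
    unfolding kuratowski_def by blast
  show ?thesis
  proof (rule that[OF r(2,3)])
    fix X x y assume "X \<in> \<C>" "x \<in> X" "y \<in> X"
    then show "norm (x - y) \<le> d"
      using diameter_bounded_bound[of X x y] r by (auto simp: dist_norm)
  qed
qed

lemma kuratowski_nonneg: "0 \<le> kuratowski B" if "bounded B"
  unfolding kuratowski_def
proof (rule cInf_greatest)
  have "\<bar>diameter B\<bar> + 1 \<in> {d. 0 < d \<and> (\<exists>\<C>. finite \<C> \<and> B \<subseteq> \<Union>\<C> \<and> (\<forall>X\<in>\<C>. bounded X \<and> diameter X \<le> d))}"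
    using that by (auto intro!: exI[of _ "{B}"])
  then show "{d. 0 < d \<and> (\<exists>\<C>. finite \<C> \<and> B \<subseteq> \<Union>\<C> \<and> (\<forall>X\<in>\<C>. bounded X \<and> diameter X \<le> d))} \<noteq> {}"
    by blast
qed auto

lemma kuratowski_bound:
  fixes B :: "'a::real_normed_vector set"
  assumes "\<And>x. x \<in> B \<Longrightarrow> norm x \<le> r" "0 \<le> r"
  shows "kuratowski B \<le> 2 * r"
proof (rule kuratowski_le[of "{B}"])
  fix X x y assume "X \<in> {B}" "x \<in> X" "y \<in> X"
  then show "norm (x - y) \<le> 2 * r"
    using norm_triangle_ineq4[of x y] assms(1)[of x] assms(1)[of y] by simp
qed (use assms in auto)

text \<open>An extra point costs only one singleton in the cover. This later discards the initial
  iterate, which is not given as an integral.\<close>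

lemma kuratowski_insert_le:
  fixes B :: "'a::real_normed_vector set"
  assumes "bounded B"
  shows "kuratowski (insert a B) \<le> kuratowski B"
proof (rule field_le_epsilon)
  fix e :: real assume e: "e > 0"
  obtain \<C> where C: "finite \<C>" "B \<subseteq> \<Union>\<C>"
    "\<And>X x y. X \<in> \<C> \<Longrightarrow> x \<in> X \<Longrightarrow> y \<in> X \<Longrightarrow> norm (x - y) \<le> kuratowski B + e"
    using kuratowski_cover[OF assms, of "kuratowski B + e"] e by auto
  show "kuratowski (insert a B) \<le> kuratowski B + e"
    by (rule kuratowski_le[of "insert {a} \<C>"])
       (use C e kuratowski_nonneg[OF assms] in auto)
qed

text \<open>The images of the covering sets form a cover with distances scaled by at most
  \<open>norm L\<close>. Any \<open>M\<close> above the norm is allowed, so that one constant serves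
  all operators of a bounded semigroup.\<close>

lemma kuratowski_blinfun_image_le:
  fixes L :: "'a::real_normed_vector \<Rightarrow>\<^sub>L 'b::real_normed_vector"
  assumes B: "bounded B" and M: "norm L \<le> M"
  shows "kuratowski (blinfun_apply L ` B) \<le> M * kuratowski B"
proof (rule le_epsilon_mult)
  fix e :: real assume e: "e > 0"
  have M0: "0 \<le> M" using M norm_ge_zero[of L] by linarith
  obtain \<C> where C: "finite \<C>" "B \<subseteq> \<Union>\<C>"
    "\<And>X x y. X \<in> \<C> \<Longrightarrow> x \<in> X \<Longrightarrow> y \<in> X \<Longrightarrow> norm (x - y) \<le> kuratowski B + e"
    using kuratowski_cover[OF B, of "kuratowski B + e"] e by auto
  have "kuratowski (blinfun_apply L ` B) \<le> M * (kuratowski B + e)"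
  proof (rule kuratowski_le[of "(\<lambda>X. blinfun_apply L ` X) ` \<C>"])
    fix X x y assume "X \<in> (\<lambda>X. blinfun_apply L ` X) ` \<C>" "x \<in> X" "y \<in> X"
    then obtain X' x' y' where X': "X' \<in> \<C>" "x' \<in> X'" "y' \<in> X'" "x = L x'" "y = L y'" by blast
    have "norm (x - y) \<le> norm L * norm (x' - y')"
      unfolding X' blinfun.diff_right[symmetric] by (rule norm_blinfun)
    also have "\<dots> \<le> M * (kuratowski B + e)"
      using C(3)[OF X'(1-3)] M M0 by (intro mult_mono) auto
    finally show "norm (x - y) \<le> M * (kuratowski B + e)" .
  next
    show "blinfun_apply L ` B \<subseteq> \<Union> ((\<lambda>X. blinfun_apply L ` X) ` \<C>)" using C(2) by blast
    show "0 \<le> M * (kuratowski B + e)" using M0 e kuratowski_nonneg[OF B] by simp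
  qed (use C in simp)
  then show "kuratowski (blinfun_apply L ` B) \<le> M * kuratowski B + e * M"
    by (simp add: algebra_simps)
qed (use M norm_ge_zero[of L] in linarith)

text \<open>The \<open>g n\<close> need not be equicontinuous, which costs the factor \<open>2\<close>. Let \<open>x\<close> enumerate a dense
  set of values. By dominated convergence, for large \<open>m\<close> the mean distance of \<open>g n\<close> to
  \<open>x 0, \<dots>, x m\<close> is about \<open>\<kappa>\<close>, uniformly in \<open>n\<close>. A partition of unity then approximates \<open>g n\<close> by
  functions with values in the convex hull of these points, so all the integrals lie within
  \<open>(b - a) * \<kappa>\<close> of a compact set.\<close>

lemma kuratowski_integral_le:
  fixes g :: "nat \<Rightarrow> real \<Rightarrow> 'a::banach"
  assumes ab: "a < b" and cont: "\<And>n. continuous_on {a..b} (g n)"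
    and bd: "\<And>n s. s \<in> {a..b} \<Longrightarrow> norm (g n s) \<le> B"
    and \<kappa>: "\<And>s. s \<in> {a..b} \<Longrightarrow> kuratowski (range (\<lambda>n. g n s)) \<le> \<kappa>"
  shows "kuratowski (range (\<lambda>n. integral {a..b} (g n))) \<le> 2 * (b - a) * \<kappa>"
proof (rule le_epsilon_mult)
  fix e :: real assume e: "e > 0"
  have bdd: "bounded (range (\<lambda>n. g n s))" if "s \<in> {a..b}" for s
    using bd[OF that] by (auto simp: bounded_iff)
  have \<kappa>0: "0 \<le> \<kappa>"
    using kuratowski_nonneg[OF bdd[of a]] \<kappa>[of a] ab by simp
  \<comment> \<open>Rational times make the set of values countable; continuity of each
    \<open>g n\<close> makes it dense among all values.\<close>
  define Y where "Y = (\<lambda>(n, q). g n q) ` (UNIV \<times> ({a..b} \<inter> \<rat>))"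
  define x where "x = from_nat_into Y"
  obtain q0 where "q0 \<in> \<rat>" "a < q0" "q0 < b"
    using Rats_dense_in_real[OF ab] by blast
  then have "q0 \<in> {a..b} \<inter> \<rat>" by simp
  then have Y: "countable Y" "Y \<noteq> {}"
    by (auto simp: Y_def countable_rat)
  then have xY: "range x = Y"
    by (simp add: x_def range_from_nat_into)
  have dense: "\<exists>j. dist (g n s) (x j) < e" if s: "s \<in> {a..b}" for n s
  proof -
    from cont[of n] s e obtain d where d: "d > 0"
      "\<And>r. r \<in> {a..b} \<Longrightarrow> dist r s < d \<Longrightarrow> dist (g n r) (g n s) < e"
      unfolding continuous_on_iff by metis
    have "max a (s - d) < min b (s + d)"
      using s d(1) ab by auto
    then obtain q where q: "q \<in> \<rat>" "max a (s - d) < q" "q < min b (s + d)"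
      using Rats_dense_in_real by blast
    then have "dist (g n q) (g n s) < e"
      by (intro d(2)) (auto simp: dist_real_def)
    moreover have "g n q \<in> Y"
      unfolding Y_def using q by (intro image_eqI[of _ _ "(n, q)"]) auto
    ultimately show ?thesis
      unfolding xY[symmetric] by (metis dist_commute imageE)
  qed
  define P where "P m y = infdist y (x ` {..m})" for m y
  have P_le: "P m y \<le> dist y (x j)" if "j \<le> m" for m y j
    unfolding P_def using that by (intro infdist_le) auto
  have P0: "0 \<le> P m y" for m y
    by (simp add: P_def infdist_nonneg)
  have P_cont: "continuous_on {a..b} (\<lambda>s. P m (g n s))" for m n
    unfolding P_def by (intro continuous_intros cont)
  \<comment> \<open>The excess of the distance over the level that can be guaranteed pointwise:
    \<open>\<kappa> + e\<close> for a covering set, and one more \<open>e\<close> for replacing one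
    of its members by some \<open>x j\<close>.\<close>
  define Q where "Q m n s = max 0 (P m (g n s) - (\<kappa> + 2 * e))" for m n s
  have Q_cont: "continuous_on {a..b} (Q m n)" for m n
    unfolding Q_def by (intro continuous_intros P_cont)
  \<comment> \<open>Uniformity in \<open>n\<close> comes by contradiction: a bad index
    \<open>k m\<close> for every \<open>m\<close> produces a single sequence of functions. At each
    fixed \<open>s\<close> it is eventually 0, since a finite cover deals with all \<open>n\<close>
    at once.\<close>
  have "\<exists>m. \<forall>n. integral {a..b} (Q m n) \<le> e"
  proof (rule ccontr)
    assume "\<not> ?thesis"
    then obtain k where k: "\<And>m. e < integral {a..b} (Q m (k m))"
      by (metis not_le)
    have "(\<lambda>m. integral {a..b} (Q m (k m))) \<longlonglongrightarrow> integral {a..b} (\<lambda>_. 0::real)"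
    proof (rule dominated_convergence(2)[where h = "\<lambda>_. B + norm (x 0)"])
      show "Q m (k m) integrable_on {a..b}" for m
        by (intro integrable_continuous_real Q_cont)
      show "norm (Q m (k m) s) \<le> B + norm (x 0)" if "s \<in> {a..b}" for m s
      proof -
        have "P m (g (k m) s) \<le> dist (g (k m) s) (x 0)"
          by (rule P_le) simp
        also have "\<dots> \<le> norm (g (k m) s) + norm (x 0)"
          by (simp add: dist_norm norm_triangle_ineq4)
        also have "\<dots> \<le> B + norm (x 0)"
          using bd[OF that] by simp
        finally show ?thesis
          using P0[of m "g (k m) s"] \<kappa>0 e by (simp add: Q_def)
      qed
      show "(\<lambda>m. Q m (k m) s) \<longlonglongrightarrow> 0" if s: "s \<in> {a..b}" for s
      proof -
        have "kuratowski (range (\<lambda>n. g n s)) < \<kappa> + e" using \<kappa>[OF s] e by simp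
        from kuratowski_cover[OF bdd[OF s] this]
        obtain \<C> where C: "finite \<C>" "range (\<lambda>n. g n s) \<subseteq> \<Union>\<C>"
          "\<And>X x y. X \<in> \<C> \<Longrightarrow> x \<in> X \<Longrightarrow> y \<in> X \<Longrightarrow> norm (x - y) \<le> \<kappa> + e"
          by blast
        have "\<exists>j. \<forall>n. g n s \<in> X \<longrightarrow> dist (g n s) (x j) \<le> \<kappa> + 2 * e" if X: "X \<in> \<C>" for X
        proof (cases "\<exists>n. g n s \<in> X")
          case True
          then obtain n where n: "g n s \<in> X" by blast
          obtain j where j: "dist (g n s) (x j) < e" using dense[OF s] by blast
          have "dist (g n' s) (x j) \<le> \<kappa> + 2 * e" if "g n' s \<in> X" for n'
            using C(3)[OF X that n] j dist_triangle[of "g n' s" "x j" "g n s"]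
            by (simp add: dist_norm)
          then show ?thesis by blast
        qed blast
        then obtain j where j: "\<And>X n. X \<in> \<C> \<Longrightarrow> g n s \<in> X \<Longrightarrow> dist (g n s) (x (j X)) \<le> \<kappa> + 2 * e"
          by metis
        define m0 where "m0 = Max (insert 0 (j ` \<C>))"
        have "Q m (k m) s = 0" if m: "m \<ge> m0" for m
        proof -
          obtain X where X: "X \<in> \<C>" "g (k m) s \<in> X" using C(2) by blast
          have "j X \<le> m0"
            unfolding m0_def using C(1) X by (intro Max_ge) auto
          with m have "P m (g (k m) s) \<le> dist (g (k m) s) (x (j X))"
            by (intro P_le) simp
          also have "\<dots> \<le> \<kappa> + 2 * e"
            using j[OF X] .
          finally show ?thesis by (simp add: Q_def)
        qed
        then have "eventually (\<lambda>m. Q m (k m) s = 0) sequentially"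
          unfolding eventually_sequentially by blast
        then show ?thesis by (simp add: tendsto_eventually)
      qed
    qed auto
    then have "(\<lambda>m. integral {a..b} (Q m (k m))) \<longlonglongrightarrow> 0" by simp
    from order_tendstoD(2)[OF this e] obtain m where "integral {a..b} (Q m (k m)) < e"
      unfolding eventually_sequentially by blast
    with k[of m] show False by simp
  qed
  then obtain m where m: "\<And>n. integral {a..b} (Q m n) \<le> e" by blast
  \<comment> \<open>The weight of \<open>x j\<close> is positive only where \<open>x j\<close> is
    within \<open>e\<close> of being a nearest one among the chosen points. Some point always
    qualifies, so the sum \<open>\<Psi>\<close> can be divided by.\<close>
  define \<psi> where "\<psi> j y = max 0 (P m y + e - dist y (x j))" for j y
  define \<Psi> where "\<Psi> y = (\<Sum>j\<le>m. \<psi> j y)" for y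
  have \<psi>0: "0 \<le> \<psi> j y" for j y by (simp add: \<psi>_def)
  have \<Psi>_pos: "0 < \<Psi> y" for y
  proof -
    have "\<exists>z\<in>x ` {..m}. dist y z < P m y + e"
    proof (rule ccontr)
      assume "\<not> ?thesis"
      then have "P m y + e \<le> infdist y (x ` {..m})"
        unfolding infdist_def by (auto intro!: cINF_greatest simp: not_less)
      with e show False by (simp add: P_def)
    qed
    then obtain j where j: "j \<le> m" "dist y (x j) < P m y + e" by auto
    show ?thesis
      unfolding \<Psi>_def using j by (intro sum_pos2[of _ j] \<psi>0) (auto simp: \<psi>_def)
  qed
  define \<mu> where "\<mu> j n s = \<psi> j (g n s) / \<Psi> (g n s)" for j n s
  have \<mu>0: "0 \<le> \<mu> j n s" for j n s
    using \<psi>0 \<Psi>_pos by (simp add: \<mu>_def less_imp_le)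
  have \<mu>1: "(\<Sum>j\<le>m. \<mu> j n s) = 1" for n s
    using \<Psi>_pos[of "g n s"] by (simp add: \<mu>_def \<Psi>_def flip: sum_divide_distrib)
  have \<mu>_cont: "continuous_on {a..b} (\<mu> j n)" for j n
    unfolding \<mu>_def \<Psi>_def \<psi>_def
  proof (intro continuous_intros P_cont cont ballI)
    fix s
    show "(\<Sum>j\<le>m. max 0 (P m (g n s) + e - dist (g n s) (x j))) \<noteq> 0"
      using \<Psi>_pos[of "g n s"] by (simp add: \<Psi>_def \<psi>_def)
  qed
  define h where "h n s = (\<Sum>j\<le>m. \<mu> j n s *\<^sub>R x j)" for n s
  have h_cont: "continuous_on {a..b} (h n)" for n
    unfolding h_def by (intro continuous_intros \<mu>_cont)
  have gh: "norm (g n s - h n s) \<le> Q m n s + (\<kappa> + 3 * e)" for n s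
  proof -
    have "g n s = (\<Sum>j\<le>m. \<mu> j n s *\<^sub>R g n s)"
      using \<mu>1[of n s] by (metis scaleR_one scaleR_sum_left)
    then have "g n s - h n s = (\<Sum>j\<le>m. \<mu> j n s *\<^sub>R (g n s - x j))"
      by (simp add: h_def scaleR_diff_right sum_subtractf)
    then have "norm (g n s - h n s) \<le> (\<Sum>j\<le>m. \<mu> j n s * norm (g n s - x j))"
      using \<mu>0 by (auto intro!: order_trans[OF norm_sum] sum_mono)
    also have "\<dots> \<le> (\<Sum>j\<le>m. \<mu> j n s * (P m (g n s) + e))"
    proof (rule sum_mono)
      fix j assume "j \<in> {..m}"
      show "\<mu> j n s * norm (g n s - x j) \<le> \<mu> j n s * (P m (g n s) + e)"
      proof (cases "norm (g n s - x j) \<le> P m (g n s) + e")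
        case True
        then show ?thesis using \<mu>0 by (intro mult_left_mono) auto
      next
        case False
        then have "\<mu> j n s = 0" by (simp add: \<mu>_def \<psi>_def dist_norm)
        then show ?thesis by simp
      qed
    qed
    also have "\<dots> = P m (g n s) + e"
      by (simp add: \<mu>1 flip: sum_distrib_right)
    also have "\<dots> \<le> Q m n s + (\<kappa> + 3 * e)"
      by (simp add: Q_def)
    finally show ?thesis .
  qed
  define r where "r = e + (\<kappa> + 3 * e) * (b - a)"
  have int_gh: "norm (integral {a..b} (g n) - integral {a..b} (h n)) \<le> r" for n
  proof -
    have "integral {a..b} (g n) - integral {a..b} (h n) = integral {a..b} (\<lambda>s. g n s - h n s)"
      by (intro integral_diff[symmetric] integrable_continuous_real cont h_cont)
    also have "norm \<dots> \<le> integral {a..b} (\<lambda>s. Q m n s + (\<kappa> + 3 * e))"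
      by (intro integral_norm_bound_integral integrable_continuous_real continuous_intros
          cont h_cont Q_cont gh)
    also have "\<dots> = integral {a..b} (Q m n) + (\<kappa> + 3 * e) * (b - a)"
      using ab by (subst integral_add) (auto intro!: integrable_continuous_real Q_cont)
    also have "\<dots> \<le> r"
      using m[of n] by (simp add: r_def)
    finally show ?thesis .
  qed
  \<comment> \<open>The integral of \<open>h n\<close> is \<open>b - a\<close> times a convex
    combination of the \<open>x j\<close>, with the mean values of the \<open>\<mu> j n\<close> as
    coefficients.\<close>
  define H where "H = (\<lambda>y. (b - a) *\<^sub>R y) ` (convex hull (x ` {..m}))"
  have int_h: "integral {a..b} (h n) \<in> H" for n
  proof -
    have "integral {a..b} (h n) = (\<Sum>j\<le>m. integral {a..b} (\<mu> j n) *\<^sub>R x j)"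
      unfolding h_def using \<mu>_cont
      by (subst integral_sum)
         (auto intro!: integrable_continuous_real continuous_intros sum.cong
           integral_unique[OF has_integral_scaleR_left] integrable_integral)
    also have "\<dots> = (b - a) *\<^sub>R (\<Sum>j\<le>m. (integral {a..b} (\<mu> j n) / (b - a)) *\<^sub>R x j)"
      using ab by (simp add: scaleR_sum_right)
    also have "\<dots> \<in> H"
      unfolding H_def
    proof (intro imageI convex_sum convex_convex_hull)
      have "(\<Sum>j\<le>m. integral {a..b} (\<mu> j n)) = integral {a..b} (\<lambda>s. \<Sum>j\<le>m. \<mu> j n s)"
        by (intro integral_sum[symmetric] integrable_continuous_real \<mu>_cont) auto
      also have "\<dots> = b - a" using ab by (simp add: \<mu>1)
      finally show "(\<Sum>j\<le>m. integral {a..b} (\<mu> j n) / (b - a)) = 1"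
        using ab by (simp flip: sum_divide_distrib)
      show "0 \<le> integral {a..b} (\<mu> j n) / (b - a)" for j
        using ab by (intro divide_nonneg_pos integral_nonneg integrable_continuous_real \<mu>_cont \<mu>0) auto
      show "x j \<in> convex hull (x ` {..m})" if "j \<in> {..m}" for j
        using that by (intro hull_inc) auto
    qed auto
    finally show ?thesis .
  qed
  have "compact H"
    unfolding H_def by (intro compact_scaling finite_imp_compact_convex_hull) auto
  then obtain K where K: "finite K" "H \<subseteq> (\<Union>y\<in>K. ball y e)"
    using e unfolding compact_eq_totally_bounded by meson
  have r0: "0 \<le> r" using \<kappa>0 e ab by (simp add: r_def)
  \<comment> \<open>All the integrals lie in finitely many balls of radius \<open>r + e\<close>; the
    factor 2 is the passage from radius to diameter.\<close>
  have "kuratowski (range (\<lambda>n. integral {a..b} (g n))) \<le> 2 * (r + e)"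
  proof (rule kuratowski_le[of "(\<lambda>y. cball y (r + e)) ` K"])
    show "range (\<lambda>n. integral {a..b} (g n)) \<subseteq> \<Union> ((\<lambda>y. cball y (r + e)) ` K)"
    proof clarify
      fix n
      obtain y where y: "y \<in> K" "integral {a..b} (h n) \<in> ball y e" using K(2) int_h[of n] by blast
      then have "dist y (integral {a..b} (g n)) \<le> r + e"
        using int_gh[of n] dist_triangle[of y "integral {a..b} (g n)" "integral {a..b} (h n)"]
        by (simp add: dist_norm norm_minus_commute)
      with y show "integral {a..b} (g n) \<in> \<Union> ((\<lambda>y. cball y (r + e)) ` K)" by auto
    qed
    fix X y z assume "X \<in> (\<lambda>y. cball y (r + e)) ` K" "y \<in> X" "z \<in> X"
    then obtain c where "dist c y \<le> r + e" "dist c z \<le> r + e" by auto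
    then show "norm (y - z) \<le> 2 * (r + e)"
      using dist_triangle2[of y z c] by (simp add: dist_norm norm_minus_commute)
  qed (use K r0 e in auto)
  then show "kuratowski (range (\<lambda>n. integral {a..b} (g n))) \<le>
      2 * (b - a) * \<kappa> + e * (4 + 6 * (b - a))"
    by (simp add: r_def algebra_simps)
qed (use ab in simp)

section \<open>Semigroups and mild solutions\<close>

text \<open>With the growth rate as a parameter, one locale covers \<open>T\<close> (rate
  \<open>C\<close>) as well as the shifted semigroup (rate \<open>0\<close>).\<close>

locale C0_semigroup_growth =
  fixes T :: "real \<Rightarrow> 'a::banach \<Rightarrow>\<^sub>L 'a" and K w :: real
  assumes C0: "C0_semigroup T"
    and growth: "0 \<le> t \<Longrightarrow> norm (T t) \<le> K * exp (w * t)"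
begin

lemma apply_zero [simp]: "T 0 = id_blinfun"
  using C0 by (simp add: C0_semigroup_def)

lemma apply_add: "0 \<le> s \<Longrightarrow> 0 \<le> t \<Longrightarrow> T (s + t) x = T s (T t x)"
  using C0 by (simp add: C0_semigroup_def)

text \<open>Strong continuity settles the fixed vector \<open>y\<close>; the error
  \<open>T (f x) (g x - y)\<close> vanishes because the exponential bound stays bounded while
  \<open>f x\<close> converges.\<close>

lemma tendsto_apply:
  assumes f: "(f \<longlongrightarrow> a) G" "0 \<le> a" "eventually (\<lambda>x. 0 \<le> f x) G" and g: "(g \<longlongrightarrow> y) G"
  shows "((\<lambda>x. T (f x) (g x)) \<longlongrightarrow> T a y) G"
proof -
  have "((\<lambda>x. T (f x) y) \<longlongrightarrow> T a y) G"
  proof (rule continuous_on_tendsto_compose[OF _ f(1)])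
    show "continuous_on {0..} (\<lambda>t. T t y)"
      using C0 by (simp add: C0_semigroup_def)
  qed (use f in auto)
  moreover have "((\<lambda>x. T (f x) (g x - y)) \<longlongrightarrow> 0) G"
  proof (rule Lim_null_comparison)
    show "eventually (\<lambda>x. norm (T (f x) (g x - y)) \<le> K * exp (w * f x) * norm (g x - y)) G"
      using f(3)
    proof eventually_elim
      case (elim x)
      have "norm (T (f x) (g x - y)) \<le> norm (T (f x)) * norm (g x - y)"
        by (rule norm_blinfun)
      also have "\<dots> \<le> K * exp (w * f x) * norm (g x - y)"
        using growth[OF elim] by (intro mult_right_mono) auto
      finally show ?case .
    qed
    have "((\<lambda>x. norm (g x - y)) \<longlongrightarrow> 0) G"
      using g by (simp add: LIM_zero tendsto_norm_zero)
    then have "((\<lambda>x. K * exp (w * f x) * norm (g x - y)) \<longlongrightarrow> K * exp (w * a) * 0) G"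
      by (intro tendsto_intros f)
    then show "((\<lambda>x. K * exp (w * f x) * norm (g x - y)) \<longlongrightarrow> 0) G" by simp
  qed
  ultimately have "((\<lambda>x. T (f x) y + T (f x) (g x - y)) \<longlongrightarrow> T a y + 0) G"
    by (rule tendsto_add)
  then show ?thesis
    by (simp add: blinfun.diff_right)
qed

lemma continuous_on_apply:
  assumes "continuous_on X f" "continuous_on X g" "\<And>x. x \<in> X \<Longrightarrow> 0 \<le> f x"
  shows "continuous_on X (\<lambda>x. T (f x) (g x))"
  using assms unfolding continuous_on_def
  by (auto intro!: tendsto_apply simp: eventually_at_filter)

definition mild :: "(real \<Rightarrow> 'a) \<Rightarrow> (real \<Rightarrow> 'a) \<Rightarrow> bool" where
  "mild f u \<longleftrightarrow> (\<forall>s t. s \<le> t \<longrightarrow> u t = T (t - s) (u s) + integral {s..t} (\<lambda>r. T (t - r) (f r)))"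

lemma continuous_on_conv:
  assumes "continuous_on UNIV f" "b \<le> t"
  shows "continuous_on {a..b} (\<lambda>r. T (t - r) (f r))"
  using assms(2) by (intro continuous_on_apply continuous_intros continuous_on_subset[OF assms(1)]) auto

lemma apply_integral_conv:
  assumes "continuous_on UNIV f" "b \<le> t" "t \<le> t'"
  shows "T (t' - t) (integral {a..b} (\<lambda>r. T (t - r) (f r))) = integral {a..b} (\<lambda>r. T (t' - r) (f r))"
proof -
  have "T (t' - t) (integral {a..b} (\<lambda>r. T (t - r) (f r)))
      = integral {a..b} (\<lambda>r. T (t' - t) (T (t - r) (f r)))"
    using integral_linear[OF integrable_continuous_real[OF continuous_on_conv[OF assms(1,2)]]
        blinfun.bounded_linear_right[of "T (t' - t)"], symmetric]
    by (simp add: o_def)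
  also have "\<dots> = integral {a..b} (\<lambda>r. T (t' - r) (f r))"
    using assms(2,3) by (intro integral_cong) (simp flip: apply_add)
  finally show ?thesis .
qed

text \<open>The function \<open>r \<mapsto> T (t - r) (v r)\<close> has right derivative
  \<open>T (t - r) (v' r + A (v r))\<close>. Indeed
  \<open>T (t - r) (v r) = T (t - (r + h)) (T h (v r))\<close>, so its difference quotient is
  \<open>T (t - (r + h))\<close> applied to the quotient of \<open>v\<close> minus that of the orbit
  of \<open>v r\<close>; the latter tends to \<open>- A (v r)\<close> for positive
  \<open>h\<close>.\<close>

lemma mild_of_classical:
  assumes gen: "generator_of D (\<lambda>x. - A x) T"
    and D: "\<And>t. v t \<in> D"
    and v': "\<And>t. (v has_vector_derivative v' t) (at t)"
    and cont: "continuous_on UNIV (\<lambda>t. v' t + A (v t))"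
  shows "mild (\<lambda>t. v' t + A (v t)) v"
  unfolding mild_def
proof (intro allI impI)
  fix s t :: real assume st: "s \<le> t"
  have contv: "continuous_on UNIV v"
    using v' has_vector_derivative_continuous continuous_at_imp_continuous_on by blast
  have "integral {s..t} (\<lambda>r. T (t - r) (v' r + A (v r))) = T (t - t) (v t) - T (t - s) (v s)"
  proof (rule integral_right_derivative[OF st])
    show "continuous_on {s..t} (\<lambda>r. T (t - r) (v r))"
      by (rule continuous_on_conv[OF contv order_refl])
    show "continuous_on {s..t} (\<lambda>r. T (t - r) (v' r + A (v r)))"
      by (rule continuous_on_conv[OF cont order_refl])
    fix r assume r: "r \<in> {s..<t}"
    have "((\<lambda>h. (v (r + h) - v r) /\<^sub>R h) \<longlongrightarrow> v' r) (at_right 0)"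
    proof (rule tendsto_mono[OF at_le[OF subset_UNIV]], rule LIM_zero_cancel,
        rule tendsto_norm_zero_cancel, rule Lim_transform_eventually)
      show "((\<lambda>h. norm (v (r + h) - v r - h *\<^sub>R v' r) / norm h) \<longlongrightarrow> 0) (at 0)"
        using v'[of r] by (simp add: has_vector_derivative_def has_derivative_at)
      have "norm (v (r + h) - v r - h *\<^sub>R v' r) / norm h = norm ((v (r + h) - v r) /\<^sub>R h - v' r)"
        if "h \<noteq> 0" for h
      proof -
        have "(v (r + h) - v r) /\<^sub>R h - v' r = (v (r + h) - v r - h *\<^sub>R v' r) /\<^sub>R h"
          using that by (simp add: scaleR_diff_right)
        then show ?thesis by (simp add: divide_inverse mult.commute)
      qed
      then show "\<forall>\<^sub>F h in at 0. norm (v (r + h) - v r - h *\<^sub>R v' r) / norm h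
          = norm ((v (r + h) - v r) /\<^sub>R h - v' r)"
        by (simp add: eventually_at_filter)
    qed
    moreover have "((\<lambda>h. (T h (v r) - v r) /\<^sub>R h) \<longlongrightarrow> - A (v r)) (at_right 0)"
      using gen D unfolding generator_of_def by blast
    ultimately have lim: "((\<lambda>h. (v (r + h) - v r) /\<^sub>R h - (T h (v r) - v r) /\<^sub>R h)
        \<longlongrightarrow> v' r - - A (v r)) (at_right 0)"
      by (rule tendsto_diff)
    have "eventually (\<lambda>h. 0 < h \<and> h < t - r) (at_right (0::real))"
      using r unfolding eventually_at_right_field by (auto intro!: exI[of _ "t - r"])
    then have ev: "eventually (\<lambda>h. 0 \<le> t - (r + h)) (at_right 0)"
      by eventually_elim auto
    have "((\<lambda>h. T (t - (r + h)) ((v (r + h) - v r) /\<^sub>R h - (T h (v r) - v r) /\<^sub>R h))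
        \<longlongrightarrow> T (t - (r + 0)) (v' r - - A (v r))) (at_right 0)"
      using r by (intro tendsto_apply[OF _ _ ev lim] tendsto_intros) auto
    then have "((\<lambda>h. T (t - (r + h)) ((v (r + h) - v r) /\<^sub>R h - (T h (v r) - v r) /\<^sub>R h))
        \<longlongrightarrow> T (t - r) (v' r + A (v r))) (at_right 0)" by simp
    then show "((\<lambda>h. (T (t - (r + h)) (v (r + h)) - T (t - r) (v r)) /\<^sub>R h)
        \<longlongrightarrow> T (t - r) (v' r + A (v r))) (at_right 0)"
    proof (rule Lim_transform_eventually)
      show "\<forall>\<^sub>F h in at_right 0. T (t - (r + h)) ((v (r + h) - v r) /\<^sub>R h - (T h (v r) - v r) /\<^sub>R h)
          = (T (t - (r + h)) (v (r + h)) - T (t - r) (v r)) /\<^sub>R h"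
        using \<open>eventually (\<lambda>h. 0 < h \<and> h < t - r) (at_right 0)\<close>
      proof eventually_elim
        case (elim h)
        then have "T (t - r) (v r) = T (t - (r + h)) (T h (v r))"
          by (simp flip: apply_add)
        then show ?case
          by (simp add: blinfun.diff_right blinfun.scaleR_right algebra_simps)
      qed
    qed
  qed
  then show "v t = T (t - s) (v s) + integral {s..t} (\<lambda>r. T (t - r) (v' r + A (v r)))"
    by simp
qed

lemma shifted_C0_semigroup_growth:
  "C0_semigroup_growth (shifted_semigroup C T) K (w - C)"
proof
  show "C0_semigroup (shifted_semigroup C T)"
    unfolding C0_semigroup_def
  proof (intro conjI allI impI blinfun_eqI)
    show "continuous_on {0..} (\<lambda>t. shifted_semigroup C T t x)" for x
    proof -
      have "continuous_on {0..} (\<lambda>t. T t x)"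
        using C0 by (simp add: C0_semigroup_def)
      then show ?thesis
        unfolding shifted_semigroup_def blinfun.scaleR_left
        by (rule continuous_on_scaleR[rotated]) (intro continuous_intros)
    qed
  qed (auto simp: shifted_semigroup_def apply_add blinfun.scaleR_left blinfun.scaleR_right algebra_simps
         simp flip: exp_add)
  fix t :: real assume "0 \<le> t"
  then have "exp (- C * t) * norm (T t) \<le> exp (- C * t) * (K * exp (w * t))"
    by (intro mult_left_mono growth) auto
  also have "\<dots> = K * exp ((w - C) * t)"
    by (simp add: algebra_simps flip: exp_add)
  finally show "norm (shifted_semigroup C T t) \<le> K * exp ((w - C) * t)"
    by (simp add: shifted_semigroup_def)
qed

text \<open>Although \<open>u\<close> need not be differentiable, \<open>T (t - r) (u r)\<close> is
  differentiable in \<open>r\<close>: by the mild formula it is a constant plus an indefinite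
  integral. Multiplying it by \<open>exp (- C * (t - r))\<close> and integrating the derivative
  produces the term \<open>C *\<^sub>R u r\<close>.\<close>

lemma mild_shifted:
  assumes u: "continuous_on UNIV u" and f: "continuous_on UNIV f" and mild: "mild f u"
  shows "C0_semigroup_growth.mild (shifted_semigroup C T) (\<lambda>t. f t + C *\<^sub>R u t) u"
proof -
  interpret S: C0_semigroup_growth "shifted_semigroup C T" K "w - C"
    by (rule shifted_C0_semigroup_growth)
  show ?thesis
    unfolding S.mild_def
  proof (intro allI impI)
    fix s t :: real assume st: "s \<le> t"
    define p where "p r = T (t - s) (u s) + integral {s..r} (\<lambda>r. T (t - r) (f r))" for r
    have p: "p r = T (t - r) (u r)" if r: "r \<in> {s..t}" for r
    proof -
      have "u r = T (r - s) (u s) + integral {s..r} (\<lambda>q. T (r - q) (f q))"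
        using mild r by (simp add: mild_def)
      then show ?thesis
        using r apply_integral_conv[OF f order_refl, of r t s] apply_add[of "t - r" "r - s" "u s"]
        by (simp add: p_def blinfun.add_right)
    qed
    have p': "(p has_vector_derivative T (t - r) (f r)) (at r within {s..t})" if r: "r \<in> {s..t}" for r
      unfolding p_def
      by (auto intro!: derivative_eq_intros
          integral_has_vector_derivative[OF continuous_on_conv[OF f order_refl] r])
    have "((\<lambda>r. shifted_semigroup C T (t - r) (f r + C *\<^sub>R u r)) has_integral
        exp (- C * (t - t)) *\<^sub>R p t - exp (- C * (t - s)) *\<^sub>R p s) {s..t}"
    proof (rule fundamental_theorem_of_calculus[OF st])
      fix r assume r: "r \<in> {s..t}"
      have "((\<lambda>r. exp (- C * (t - r))) has_real_derivative exp (- C * (t - r)) * C) (at r within {s..t})"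
        by (auto intro!: derivative_eq_intros)
      from has_vector_derivative_scaleR[OF this p'[OF r]]
      show "((\<lambda>r. exp (- C * (t - r)) *\<^sub>R p r) has_vector_derivative
          shifted_semigroup C T (t - r) (f r + C *\<^sub>R u r)) (at r within {s..t})"
        by (simp add: p[OF r] shifted_semigroup_def blinfun.scaleR_left blinfun.add_right
            blinfun.scaleR_right algebra_simps)
    qed
    then have "integral {s..t} (\<lambda>r. shifted_semigroup C T (t - r) (f r + C *\<^sub>R u r))
        = u t - shifted_semigroup C T (t - s) (u s)"
      using st by (simp add: integral_unique p shifted_semigroup_def blinfun.scaleR_left)
    then show "u t = shifted_semigroup C T (t - s) (u s)
        + integral {s..t} (\<lambda>r. shifted_semigroup C T (t - r) (f r + C *\<^sub>R u r))"
      by simp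
  qed
qed

end

lemma shifted_semigroup_uminus [simp]: "shifted_semigroup (- C) (shifted_semigroup C T) = T"
  by (rule ext) (simp add: shifted_semigroup_def flip: exp_add)

text \<open>The shift works for every real constant, so the converse direction is a shift of the
  shifted semigroup by \<open>- C\<close>.\<close>

lemma (in C0_semigroup_growth) mild_shifted_iff:
  assumes u: "continuous_on UNIV u" and f: "continuous_on UNIV f"
  shows "C0_semigroup_growth.mild (shifted_semigroup C T) (\<lambda>t. f t + C *\<^sub>R u t) u \<longleftrightarrow> mild f u"
proof
  interpret S: C0_semigroup_growth "shifted_semigroup C T" K "w - C"
    by (rule shifted_C0_semigroup_growth)
  assume "C0_semigroup_growth.mild (shifted_semigroup C T) (\<lambda>t. f t + C *\<^sub>R u t) u"
  then show "mild f u"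
    using S.mild_shifted[OF u, of "\<lambda>t. f t + C *\<^sub>R u t" "- C"] u f
    by (simp add: continuous_intros)
qed (rule mild_shifted[OF u f])

text \<open>The Cesaro means of the partial sums of the Neumann series, all of which are positive,
  converge to the resolvent as soon as the powers of \<open>L\<close> are bounded; the spectral radius
  of \<open>L\<close> may be \<open>1\<close>.\<close>

lemma inverse_id_minus_positive:
  fixes L R :: "'a::ordered_banach \<Rightarrow>\<^sub>L 'a"
  assumes inv: "is_blinfun_inverse (id_blinfun - L) R"
    and pos: "\<And>x. 0 \<le> x \<Longrightarrow> 0 \<le> L x"
    and bdd: "\<And>n x. norm ((blinfun_apply L ^^ n) x) \<le> K * norm x"
    and x: "0 \<le> x"
  shows "0 \<le> R x"
proof -
  let ?L = "\<lambda>n. blinfun_apply L ^^ n"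
  have eq: "R y - L (R y) = y" for y
  proof -
    have "(id_blinfun - L) (R y) = ((id_blinfun - L) o\<^sub>L R) y" by simp
    also have "\<dots> = y" using inv by (simp add: is_blinfun_inverse_def)
    finally show ?thesis by (simp add: blinfun.diff_left)
  qed
  have L_diff: "?L n (a - b) = ?L n a - ?L n b" for n a b
    by (induction n) (auto simp: blinfun.diff_right)
  have telescope: "(\<Sum>k<m. ?L k y) = R y - ?L m (R y)" for m y
  proof (induction m)
    case (Suc m)
    have "?L m y = ?L m (R y) - ?L m (L (R y))"
      by (subst eq[of y, symmetric]) (rule L_diff)
    then show ?case using Suc by (simp add: funpow_swap1)
  qed simp
  have L_pos: "0 \<le> ?L k x" for k
    by (induction k) (use x pos in auto)
  define c where "c n = (\<Sum>m<n. \<Sum>k<m. ?L k x) /\<^sub>R real n" for n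
  \<comment> \<open>Averaging brings in a second sum of powers, now applied to \<open>R x\<close>.
    It telescopes as well, which leaves a bounded remainder divided by \<open>n\<close>.\<close>
  have c_eq: "c n = R x - (R (R x) - ?L n (R (R x))) /\<^sub>R real n" if "n > 0" for n
  proof -
    have "(\<Sum>m<n. \<Sum>k<m. ?L k x) = real n *\<^sub>R R x - (\<Sum>m<n. ?L m (R x))"
      by (simp add: telescope sum_subtractf sum_constant_scaleR)
    then show ?thesis
      using that by (simp add: c_def telescope scaleR_diff_right)
  qed
  have "(\<lambda>n. (R (R x) - ?L n (R (R x))) /\<^sub>R real n) \<longlonglongrightarrow> 0"
  proof (rule Lim_null_comparison)
    show "\<forall>\<^sub>F n in sequentially. norm ((R (R x) - ?L n (R (R x))) /\<^sub>R real n)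
        \<le> (norm (R (R x)) + K * norm (R (R x))) / real n"
    proof (intro always_eventually allI)
      fix n
      have "norm (R (R x) - ?L n (R (R x))) \<le> norm (R (R x)) + K * norm (R (R x))"
        using norm_triangle_ineq4[of "R (R x)" "?L n (R (R x))"] bdd[of n "R (R x)"] by simp
      then show "norm ((R (R x) - ?L n (R (R x))) /\<^sub>R real n)
          \<le> (norm (R (R x)) + K * norm (R (R x))) / real n"
        by (simp add: divide_inverse mult.commute mult_left_mono)
    qed
    show "(\<lambda>n. (norm (R (R x)) + K * norm (R (R x))) / real n) \<longlonglongrightarrow> 0"
      by (rule lim_const_over_n)
  qed
  from tendsto_diff[OF tendsto_const this]
  have "(\<lambda>n. R x - (R (R x) - ?L n (R (R x))) /\<^sub>R real n) \<longlonglongrightarrow> R x" by simp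
  then have "c \<longlonglongrightarrow> R x"
  proof (rule Lim_transform_eventually)
    show "\<forall>\<^sub>F n in sequentially. R x - (R (R x) - ?L n (R (R x))) /\<^sub>R real n = c n"
      using eventually_gt_at_top[of 0] by eventually_elim (simp add: c_eq)
  qed
  moreover have "0 \<le> c n" for n
    unfolding c_def by (intro scaleR_nonneg_nonneg sum_nonneg L_pos) auto
  ultimately show ?thesis
    by (intro tendsto_le_ordered_banach[of "\<lambda>_. 0" 0 sequentially c]) auto
qed

section \<open>Periodic solutions of the linear equation\<close>

lemma C_per_continuous: "u \<in> C_per \<omega> \<Longrightarrow> continuous_on X u"
  by (auto simp: C_per_def intro: continuous_on_subset)

lemma C_per_shift_into_period:
  assumes "u \<in> C_per \<omega>" "0 < \<omega>"
  obtains s where "s \<in> {0..\<omega>}" "u t = u s"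
proof -
  interpret periodic_fun_simple u \<omega>
    using assms by unfold_locales (simp add: C_per_def)
  have "u (frac (t / \<omega>) * \<omega> + of_int \<lfloor>t / \<omega>\<rfloor> * \<omega>) = u (frac (t / \<omega>) * \<omega>)"
    by (rule plus_of_int)
  moreover have "frac (t / \<omega>) * \<omega> + of_int \<lfloor>t / \<omega>\<rfloor> * \<omega> = t"
    using assms by (simp add: frac_def field_simps)
  moreover have "frac (t / \<omega>) * \<omega> \<in> {0..\<omega>}"
    using assms frac_ge_0[of "t / \<omega>"] frac_lt_1[of "t / \<omega>"] by (simp add: mult_left_le_one_le)
  ultimately show ?thesis using that by metis
qed

lemma C_per_bounded:
  fixes u :: "real \<Rightarrow> 'a::real_normed_vector"
  assumes u: "u \<in> C_per \<omega>" "0 < \<omega>"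
  obtains B where "0 \<le> B" "\<And>t. norm (u t) \<le> B"
proof -
  have "compact (u ` {0..\<omega>})"
    by (intro compact_continuous_image C_per_continuous[OF u(1)] compact_Icc)
  then have "bounded (u ` {0..\<omega>})"
    by (rule compact_imp_bounded)
  then obtain B where B: "\<And>s. s \<in> {0..\<omega>} \<Longrightarrow> norm (u s) \<le> B"
    by (metis bounded_iff imageI)
  have "norm (u t) \<le> B" for t
    using C_per_shift_into_period[OF u, of t] B by metis
  moreover from this[of 0] have "0 \<le> B"
    using norm_ge_zero order_trans by blast
  ultimately show ?thesis using that by blast
qed

lemma C_per_diff:
  fixes u v :: "real \<Rightarrow> 'a::real_normed_vector"
  shows "u \<in> C_per \<omega> \<Longrightarrow> v \<in> C_per \<omega> \<Longrightarrow> (\<lambda>t. u t - v t) \<in> C_per \<omega>"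
  by (auto simp: C_per_def intro!: continuous_intros)

section \<open>Convergence of integrals and of monotone sequences\<close>

lemma integral_norm_tendsto_zero:
  fixes f :: "nat \<Rightarrow> real \<Rightarrow> 'a::real_normed_vector"
  assumes "\<And>n. continuous_on {a..b} (f n)" "\<And>n s. norm (f n s) \<le> B"
    and "\<And>s. (\<lambda>n. f n s) \<longlonglongrightarrow> 0"
  shows "(\<lambda>n. integral {a..b} (\<lambda>s. norm (f n s))) \<longlonglongrightarrow> 0"
proof -
  have "(\<lambda>n. integral {a..b} (\<lambda>s. norm (f n s))) \<longlonglongrightarrow> integral {a..b} (\<lambda>_. 0::real)"
  proof (rule dominated_convergence(2)[where h = "\<lambda>_. B"])
    show "(\<lambda>n. norm (f n s)) \<longlonglongrightarrow> 0" for s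
      by (rule tendsto_norm_zero[OF assms(3)])
  qed (use assms in \<open>auto intro!: integrable_continuous_real continuous_intros\<close>)
  then show ?thesis by simp
qed

text \<open>By pigeonhole, one set of a fine finite cover contains infinitely many terms. Every term
  after the first chosen one, \<open>y k\<close>, is enclosed between it and a later term of the
  same set, and normality turns this enclosure into a norm estimate.\<close>

lemma monotone_Cauchy:
  fixes y :: "nat \<Rightarrow> 'a::ordered_banach"
  assumes normal: "\<And>x y::'a. 0 \<le> x \<Longrightarrow> x \<le> y \<Longrightarrow> norm x \<le> N * norm y" and N: "0 \<le> N"
    and mono: "incseq y \<or> decseq y"
    and bdd: "bounded (range y)" and kur: "kuratowski (range y) \<le> 0"
  shows "Cauchy y"
proof (rule metric_CauchyI)
  fix e :: real assume e: "e > 0"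
  \<comment> \<open>Two terms within \<open>N * d\<close> of \<open>y k\<close> are then less than
    \<open>e\<close> apart, also when \<open>N = 0\<close>.\<close>
  define d where "d = e / (2 * N + 1)"
  have d: "d > 0" using e N by (simp add: d_def)
  have "2 * (N * d) < e" using e N by (simp add: d_def field_simps)
  obtain \<C> where C: "finite \<C>" "range y \<subseteq> \<Union>\<C>"
    "\<And>X p q. X \<in> \<C> \<Longrightarrow> p \<in> X \<Longrightarrow> q \<in> X \<Longrightarrow> norm (p - q) \<le> d"
    using kuratowski_cover[OF bdd, of d] kur d by auto
  have "\<exists>X\<in>\<C>. infinite {n. y n \<in> X}"
  proof (rule ccontr)
    assume "\<not> ?thesis"
    then have "finite (\<Union>X\<in>\<C>. {n. y n \<in> X})" using C(1) by auto
    moreover have "(\<Union>X\<in>\<C>. {n. y n \<in> X}) = UNIV" using C(2) by blast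
    ultimately show False by simp
  qed
  then obtain X where X: "X \<in> \<C>" "infinite {n. y n \<in> X}" by blast
  then obtain k where k: "y k \<in> X" using infinite_imp_nonempty by blast
  have close: "norm (y n - y k) \<le> N * d" if n: "k \<le> n" for n
  proof -
    obtain m where m: "n \<le> m" "y m \<in> X"
      using X(2) unfolding infinite_nat_iff_unbounded_le by blast
    have "norm (y n - y k) \<le> N * norm (y m - y k)"
      using mono
    proof
      assume "incseq y"
      then show ?thesis using n m(1) by (intro normal) (auto simp: incseq_def)
    next
      assume "decseq y"
      then have "norm (y k - y n) \<le> N * norm (y k - y m)"
        using n m(1) by (intro normal) (auto simp: decseq_def)
      then show ?thesis by (simp add: norm_minus_commute)
    qed
    also have "\<dots> \<le> N * d"
      using C(3)[OF X(1) m(2) k] N by (intro mult_left_mono)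
    finally show ?thesis .
  qed
  have "dist (y m) (y n) < e" if "k \<le> m" "k \<le> n" for m n
    using close[OF that(1)] close[OF that(2)] dist_triangle2[of "y m" "y n" "y k"] \<open>2 * (N * d) < e\<close>
    by (simp add: dist_norm)
  then show "\<exists>k. \<forall>m\<ge>k. \<forall>n\<ge>k. dist (y m) (y n) < e" by blast
qed

text \<open>Here \<open>T\<close> plays the part of the shifted semigroup \<open>S\<close>: growth
  rate \<open>0\<close> says that it is bounded by \<open>M\<close>, and \<open>R\<close> is the
  inverse of \<open>I - S(\<omega>)\<close>.\<close>

locale positive_periodic_semigroup = C0_semigroup_growth T M 0
  for T :: "real \<Rightarrow> 'a::ordered_banach \<Rightarrow>\<^sub>L 'a" and M :: real +
  fixes \<omega> :: real and R :: "'a \<Rightarrow>\<^sub>L 'a"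
  assumes period_pos: "0 < \<omega>"
    and inverse: "is_blinfun_inverse (id_blinfun - T \<omega>) R"
    and positive: "positive_semigroup T"
begin

lemma norm_le: "0 \<le> t \<Longrightarrow> norm (T t) \<le> M"
  using growth[of t] by simp

lemma M_nonneg: "0 \<le> M"
  using norm_le[of 0] norm_ge_zero order_trans by blast

lemma norm_apply_le: "0 \<le> t \<Longrightarrow> norm (T t x) \<le> M * norm x"
  using norm_blinfun[of "T t" x] norm_le[of t] by (meson mult_right_mono norm_ge_zero order_trans)

lemma apply_mono: "0 \<le> t \<Longrightarrow> x \<le> y \<Longrightarrow> T t x \<le> T t y"
  using positive[unfolded positive_semigroup_def, rule_format, of t "y - x"]
  by (simp add: blinfun.diff_right)

lemma R_left: "R (x - T \<omega> x) = x"
proof -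
  have "(R o\<^sub>L (id_blinfun - T \<omega>)) x = x"
    using inverse by (simp add: is_blinfun_inverse_def)
  then show ?thesis by (simp add: blinfun.diff_left)
qed

lemma R_right: "R x - T \<omega> (R x) = x"
proof -
  have "((id_blinfun - T \<omega>) o\<^sub>L R) x = x"
    using inverse by (simp add: is_blinfun_inverse_def)
  then show ?thesis by (simp add: blinfun.diff_left)
qed

text \<open>Applying \<open>T t\<close> to \<open>x = R x - T \<omega> (R x)\<close> exhibits
  \<open>T t x\<close> as the image of \<open>T t (R x)\<close> under
  \<open>I - T \<omega>\<close>.\<close>

lemma R_commute:
  assumes t: "0 \<le> t"
  shows "R (T t x) = T t (R x)"
proof -
  have "T t (T \<omega> (R x)) = T \<omega> (T t (R x))"
    using t period_pos apply_add[of t \<omega> "R x"] apply_add[of \<omega> t "R x"] by (simp add: add.commute)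
  then have "T t x = T t (R x) - T \<omega> (T t (R x))"
    using R_right[of x] by (metis blinfun.diff_right)
  then show ?thesis by (simp add: R_left)
qed

lemma R_mono:
  assumes "x \<le> y"
  shows "R x \<le> R y"
proof -
  \<comment> \<open>The powers of \<open>T \<omega>\<close> belong to the semigroup, so they share
    its bound \<open>M\<close>.\<close>
  have pow: "(blinfun_apply (T \<omega>) ^^ n) x = T (real n * \<omega>) x" for n x
    using period_pos by (induction n) (simp_all add: algebra_simps flip: apply_add)
  have "0 \<le> R (y - x)"
  proof (rule inverse_id_minus_positive[OF inverse])
    show "0 \<le> T \<omega> z" if "0 \<le> z" for z
      using apply_mono[of \<omega> 0 z] period_pos that by (simp add: blinfun.zero_right)
    show "norm ((blinfun_apply (T \<omega>) ^^ n) z) \<le> M * norm z" for n z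
      unfolding pow using period_pos by (intro norm_apply_le) simp
  qed (use assms in simp)
  then show ?thesis by (simp add: blinfun.diff_right)
qed

text \<open>The formula is forced: the mild formula over one period, combined with
  \<open>u (t - \<omega>) = u t\<close>, gives \<open>u t - T \<omega> (u t)\<close> as the
  integral, and \<open>R\<close> solves for \<open>u t\<close>.\<close>

definition per_sol :: "(real \<Rightarrow> 'a) \<Rightarrow> real \<Rightarrow> 'a" where
  "per_sol f t = R (integral {t - \<omega>..t} (\<lambda>s. T (t - s) (f s)))"

text \<open>A substitution moves \<open>t\<close> from the limits of integration into the argument
  of \<open>f\<close>, after which continuity is that of a parameter integral.\<close>

lemma per_sol_C_per:
  assumes f: "f \<in> C_per \<omega>"
  shows "per_sol f \<in> C_per \<omega>"
proof -
  have eq: "per_sol f t = R (integral {0..\<omega>} (\<lambda>s. T (\<omega> - s) (f (s + (t - \<omega>)))))" for t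
    using integral_shift_real_ivl[of "t - \<omega>" "t - \<omega>" t "\<lambda>s. T (t - s) (f s)"]
    by (simp add: per_sol_def algebra_simps)
  have "continuous_on (UNIV \<times> cbox 0 \<omega>) (\<lambda>(t, s). T (\<omega> - s) (f (s + (t - \<omega>))))"
    unfolding case_prod_unfold
    by (intro continuous_on_apply continuous_intros
        continuous_on_compose2[OF C_per_continuous[OF f, of UNIV]]) auto
  from integral_continuous_on_param[OF this]
  have "continuous_on UNIV (per_sol f)"
    unfolding eq[abs_def] by (intro continuous_intros) simp
  moreover have "f (s + (t + \<omega> - \<omega>)) = f (s + (t - \<omega>))" for s t
    using f[unfolded C_per_def, THEN CollectD, THEN conjunct2, rule_format, of "s + (t - \<omega>)"]
    by (simp add: algebra_simps)
  ultimately show ?thesis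
    unfolding C_per_def mem_Collect_eq eq by presburger
qed

lemma per_sol_mono:
  assumes "continuous_on UNIV f" "continuous_on UNIV g" "\<And>t. f t \<le> g t"
  shows "per_sol f t \<le> per_sol g t"
  unfolding per_sol_def
proof (intro R_mono integral_mono_ordered_banach)
  show "T (t - s) (f s) \<le> T (t - s) (g s)" if "s \<in> {t - \<omega>..t}" for s
    using that assms(3) by (intro apply_mono) auto
qed (intro continuous_on_conv assms order_refl)+

text \<open>By periodicity \<open>t\<close> may be taken in one period, and then every integration
  window lies in \<open>{- \<omega>..\<omega>}\<close>. The bound is therefore uniform in
  \<open>t\<close>, so pointwise convergence of the right-hand sides can yield uniform convergence
  of the solutions.\<close>

lemma per_sol_dist:
  assumes f: "f \<in> C_per \<omega>" and g: "g \<in> C_per \<omega>"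
  shows "norm (per_sol f t - per_sol g t) \<le> norm R * M * integral {- \<omega>..\<omega>} (\<lambda>s. norm (f s - g s))"
proof -
  obtain s where s: "s \<in> {0..\<omega>}" "per_sol f t - per_sol g t = per_sol f s - per_sol g s"
    using C_per_shift_into_period[OF C_per_diff[OF per_sol_C_per[OF f] per_sol_C_per[OF g]] period_pos, of t]
    by blast
  note int = integrable_continuous_real[OF continuous_on_conv[OF C_per_continuous order_refl]]
  have cont: "continuous_on X (\<lambda>s. norm (f s - g s))" for X
    by (intro continuous_intros C_per_continuous[OF f] C_per_continuous[OF g])
  have "per_sol f s - per_sol g s = R (integral {s - \<omega>..s} (\<lambda>r. T (s - r) (f r - g r)))"
    unfolding per_sol_def blinfun.diff_right[symmetric]
    by (simp add: integral_diff[OF int[OF f] int[OF g]] blinfun.diff_right)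
  also have "norm \<dots> \<le> norm R * norm (integral {s - \<omega>..s} (\<lambda>r. T (s - r) (f r - g r)))"
    by (rule norm_blinfun)
  also have "\<dots> \<le> norm R * integral {s - \<omega>..s} (\<lambda>r. M * norm (f r - g r))"
  proof (intro mult_left_mono integral_norm_bound_integral)
    show "(\<lambda>r. T (s - r) (f r - g r)) integrable_on {s - \<omega>..s}"
      by (rule int[OF C_per_diff[OF f g]])
    show "(\<lambda>r. M * norm (f r - g r)) integrable_on {s - \<omega>..s}"
      by (intro integrable_continuous_real continuous_intros cont)
  qed (auto intro: norm_apply_le)
  also have "\<dots> = norm R * M * integral {s - \<omega>..s} (\<lambda>r. norm (f r - g r))"
    by simp
  also have "\<dots> \<le> norm R * M * integral {- \<omega>..\<omega>} (\<lambda>s. norm (f s - g s))"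
    using s(1) M_nonneg
    by (intro mult_left_mono integral_subset_le integrable_continuous_real cont) auto
  finally show ?thesis using s(2) by simp
qed

lemma per_sol_of_mild:
  assumes u: "u \<in> C_per \<omega>" and mild: "mild f u"
  shows "per_sol f = u"
proof
  fix t
  have "u t = T (t - (t - \<omega>)) (u (t - \<omega>)) + integral {t - \<omega>..t} (\<lambda>r. T (t - r) (f r))"
    by (rule mild[unfolded mild_def, rule_format]) (use period_pos in simp)
  moreover have "u (t - \<omega>) = u t"
    using u unfolding C_per_def by (metis (mono_tags, lifting) CollectD diff_add_cancel)
  ultimately have "integral {t - \<omega>..t} (\<lambda>r. T (t - r) (f r)) = u t - T \<omega> (u t)"
    by (simp add: algebra_simps)
  then show "per_sol f t = u t"
    by (simp add: per_sol_def R_left)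
qed

text \<open>For the converse, the integral over \<open>{s - \<omega>..t}\<close> is split once at
  \<open>s\<close> and once at \<open>t - \<omega>\<close>. Periodicity of \<open>f\<close> turns
  the piece up to \<open>t - \<omega>\<close> into \<open>T \<omega>\<close> of the integral over
  \<open>{s..t}\<close>, and \<open>R\<close> cancels the resulting
  \<open>I - T \<omega>\<close>.\<close>

lemma per_sol_eq_iff_mild:
  assumes u: "u \<in> C_per \<omega>" and f: "f \<in> C_per \<omega>"
  shows "per_sol f = u \<longleftrightarrow> mild f u"
proof (rule iffI[OF _ per_sol_of_mild[OF u]])
  assume eq: "per_sol f = u"
  have contf: "continuous_on UNIV f" by (rule C_per_continuous[OF f])
  show "mild f u"
    unfolding mild_def
  proof (intro allI impI)
    fix s t :: real assume st: "s \<le> t"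
    let ?I = "\<lambda>a b. integral {a..b} (\<lambda>r. T (t - r) (f r))"
    have int: "(\<lambda>r. T (t - r) (f r)) integrable_on {a..t}" for a
      by (intro integrable_continuous_real continuous_on_conv[OF contf order_refl])
    have "?I (s - \<omega>) s + ?I s t = ?I (s - \<omega>) t"
      by (rule Henstock_Kurzweil_Integration.integral_combine[OF _ _ int]) (use st period_pos in auto)
    moreover have "?I (s - \<omega>) (t - \<omega>) + ?I (t - \<omega>) t = ?I (s - \<omega>) t"
      by (rule Henstock_Kurzweil_Integration.integral_combine[OF _ _ int]) (use st period_pos in auto)
    moreover have "T (t - s) (integral {s - \<omega>..s} (\<lambda>r. T (s - r) (f r))) = ?I (s - \<omega>) s"
      by (rule apply_integral_conv[OF contf order_refl st])
    moreover have "?I (s - \<omega>) (t - \<omega>) = T \<omega> (?I s t)"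
    proof -
      have "?I (s - \<omega>) (t - \<omega>) = integral {s..t} (\<lambda>r. T (t + \<omega> - r) (f r))"
        using integral_shift_real_ivl[of s \<omega> t "\<lambda>r. T (t + \<omega> - r) (f r)"] f
        by (simp add: C_per_def algebra_simps)
      also have "\<dots> = T \<omega> (?I s t)"
        using apply_integral_conv[OF contf order_refl, of t "t + \<omega>" s] period_pos by simp
      finally show ?thesis .
    qed
    ultimately have "?I (t - \<omega>) t = T (t - s) (integral {s - \<omega>..s} (\<lambda>r. T (s - r) (f r)))
        + (?I s t - T \<omega> (?I s t))"
      by (simp add: algebra_simps)
    then have "per_sol f t = T (t - s) (per_sol f s) + ?I s t"
      using st by (simp add: per_sol_def blinfun.add_right R_left R_commute)
    then show "u t = T (t - s) (u s) + ?I s t"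
      by (simp add: eq)
  qed
qed

end

section \<open>Monotone iteration\<close>

lemma continuous_on_delayed:
  fixes u :: "real \<Rightarrow> 'a::topological_space" and g :: "real \<Rightarrow> 'a \<Rightarrow> 'a \<Rightarrow> 'b::topological_space"
  assumes g: "continuous_on UNIV (\<lambda>(t, x, y). g t x y)" and u: "continuous_on UNIV u"
  shows "continuous_on UNIV (\<lambda>s. g s (u s) (u (s - \<tau>)))"
proof -
  have "continuous_on UNIV (\<lambda>s. (\<lambda>(t, x, y). g t x y) (s, u s, u (s - \<tau>)))"
    by (rule continuous_on_compose2[OF g])
       (auto intro!: continuous_intros u continuous_on_compose2[OF u])
  then show ?thesis by simp
qed

lemma is_blinfun_inverse_blinfun_inv:
  assumes "blinfun_invertible L"
  shows "is_blinfun_inverse L (blinfun_inv L)"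
  unfolding blinfun_inv_def
proof (rule theI')
  from assms obtain R where R: "is_blinfun_inverse L R"
    by (auto simp: blinfun_invertible_def)
  moreover have "R' = R" if R': "is_blinfun_inverse L R'" for R'
  proof (rule blinfun_eqI)
    fix x
    have "L (R x) = x" "\<And>y. R' (L y) = y"
      using R R' unfolding is_blinfun_inverse_def
      by (metis blinfun_apply_blinfun_compose id_blinfun.rep_eq id_apply)+
    then show "R' x = R x" by metis
  qed
  ultimately show "\<exists>!R. is_blinfun_inverse L R" by blast
qed

lemma C_per_graph_continuous:
  assumes A: "closed_linear_op D A" and z: "z \<in> C_per_graph \<omega> D A"
  shows "continuous_on UNIV (\<lambda>t. A (z t))"
  unfolding continuous_on_def
proof (intro ballI)
  fix t
  have D: "subspace D" and z_D: "z s \<in> D" for s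
    using A z by (auto simp: closed_linear_op_def C_per_graph_def)
  have A_diff: "A (z s - z t) = A (z s) - A (z t)" for s
  proof -
    have "A (z s + - 1 *\<^sub>R z t) = A (z s) + - 1 *\<^sub>R A (z t)"
      using A z_D subspace_scale[OF D z_D, of "- 1"] unfolding closed_linear_op_def by metis
    then show ?thesis by simp
  qed
  have "((\<lambda>s. graph_norm A (z s - z t)) \<longlongrightarrow> 0) (at t)"
    using z by (simp add: C_per_graph_def)
  then have "((\<lambda>s. A (z s) - A (z t)) \<longlongrightarrow> 0) (at t)"
    by (rule Lim_null_comparison[rotated]) (simp add: graph_norm_def A_diff)
  then show "((\<lambda>t. A (z t)) \<longlongrightarrow> A (z t)) (at t)"
    by (rule LIM_zero_cancel)
qed

text \<open>\<open>g\<close> stands for \<open>F + C x\<close>, for which (i) becomes monotonicity.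
  Generator and derivatives no longer occur: of the lower and upper solutions only the inequalities
  \<open>v_sub\<close> and \<open>w_super\<close> remain.\<close>

locale monotone_delay_iteration = positive_periodic_semigroup T M \<omega> R
  for T :: "real \<Rightarrow> 'a::ordered_banach \<Rightarrow>\<^sub>L 'a" and M \<omega> :: real and R :: "'a \<Rightarrow>\<^sub>L 'a" +
  fixes \<tau> c N :: real and g :: "real \<Rightarrow> 'a \<Rightarrow> 'a \<Rightarrow> 'a" and v w :: "real \<Rightarrow> 'a"
  assumes normal: "\<And>x y::'a. 0 \<le> x \<Longrightarrow> x \<le> y \<Longrightarrow> norm x \<le> N * norm y" and N_nonneg: "0 \<le> N"
    and g_cont: "continuous_on UNIV (\<lambda>(t, x, y). g t x y)"
    and g_per: "g (t + \<omega>) x y = g t x y"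
    and v_per: "v \<in> C_per \<omega>" and w_per: "w \<in> C_per \<omega>" and v_le_w: "v t \<le> w t"
    and g_mono: "\<And>t x1 x2 y1 y2. v t \<le> x1 \<Longrightarrow> x1 \<le> x2 \<Longrightarrow> x2 \<le> w t \<Longrightarrow>
      v (t - \<tau>) \<le> y1 \<Longrightarrow> y1 \<le> y2 \<Longrightarrow> y2 \<le> w (t - \<tau>) \<Longrightarrow> g t x1 y1 \<le> g t x2 y2"
    and v_sub: "v t \<le> per_sol (\<lambda>s. g s (v s) (v (s - \<tau>))) t"
    and w_super: "per_sol (\<lambda>s. g s (w s) (w (s - \<tau>))) t \<le> w t"
    and c_nonneg: "0 \<le> c" and c_small: "c * (4 * \<omega> * norm R * M) < 1"
    and g_kuratowski: "\<And>t u. (\<And>n. u n \<in> order_interval v w) \<Longrightarrow> incseq u \<or> decseq u \<Longrightarrow>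
      kuratowski (range (\<lambda>n::nat. g t (u n t) (u n (t - \<tau>))))
        \<le> c * (kuratowski (range (\<lambda>n. u n t)) + kuratowski (range (\<lambda>n. u n (t - \<tau>))))"
begin

text \<open>The Nemytskii (superposition) operator of \<open>g\<close>, with delay.\<close>

definition Nem :: "(real \<Rightarrow> 'a) \<Rightarrow> real \<Rightarrow> 'a" where
  "Nem u s = g s (u s) (u (s - \<tau>))"

definition Q :: "(real \<Rightarrow> 'a) \<Rightarrow> real \<Rightarrow> 'a" where
  "Q u = per_sol (Nem u)"

definition per_interval :: "(real \<Rightarrow> 'a) set" where
  "per_interval = {u \<in> C_per \<omega>. v \<le> u \<and> u \<le> w}"

lemma per_intervalD:
  assumes "u \<in> per_interval"
  shows "u \<in> C_per \<omega>" "v t \<le> u t" "u t \<le> w t"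
  using assms by (auto simp: per_interval_def le_fun_def)

lemma ends_in_per_interval: "v \<in> per_interval" "w \<in> per_interval"
  using v_per w_per v_le_w by (auto simp: per_interval_def le_fun_def)

lemma Nem_C_per:
  assumes u: "u \<in> C_per \<omega>"
  shows "Nem u \<in> C_per \<omega>"
proof -
  have "continuous_on UNIV (Nem u)"
    unfolding Nem_def[abs_def] by (rule continuous_on_delayed[OF g_cont C_per_continuous[OF u]])
  moreover have "u (s + \<omega> - \<tau>) = u (s - \<tau>)" "u (s + \<omega>) = u s" for s
  proof -
    have per: "u (t + \<omega>) = u t" for t
      using u by (simp add: C_per_def)
    show "u (s + \<omega>) = u s" by (rule per)
    show "u (s + \<omega> - \<tau>) = u (s - \<tau>)" using per[of "s - \<tau>"] by (simp add: algebra_simps)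
  qed
  ultimately show ?thesis
    by (simp add: C_per_def Nem_def g_per)
qed

lemma Nem_mono:
  assumes "x \<in> per_interval" "y \<in> per_interval" "x \<le> y"
  shows "Nem x t \<le> Nem y t"
  unfolding Nem_def using assms
  by (intro g_mono) (auto simp: per_intervalD le_fun_def)

lemma Nem_tendsto:
  assumes "\<And>s. (\<lambda>n. x n s) \<longlonglongrightarrow> u s"
  shows "(\<lambda>n. Nem (x n) s) \<longlonglongrightarrow> Nem u s"
proof -
  have "(\<lambda>n. (s, x n s, x n (s - \<tau>))) \<longlonglongrightarrow> (s, u s, u (s - \<tau>))"
    by (intro tendsto_intros assms)
  from continuous_on_tendsto_compose[OF g_cont this] show ?thesis
    by (simp add: Nem_def)
qed

lemma Q_mono:
  assumes "x \<in> per_interval" "y \<in> per_interval" "x \<le> y"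
  shows "Q x \<le> Q y"
  unfolding Q_def using assms
  by (auto intro!: le_funI per_sol_mono C_per_continuous[OF Nem_C_per] Nem_mono simp: per_intervalD)

lemma v_le_Q: "v \<le> Q v" and Q_le_w: "Q w \<le> w"
  using v_sub w_super by (auto simp: le_fun_def Q_def Nem_def[abs_def])

lemma Q_in_per_interval:
  assumes u: "u \<in> per_interval"
  shows "Q u \<in> per_interval"
proof -
  have "v \<le> u" "u \<le> w" using u by (auto simp: per_interval_def)
  then have "v \<le> Q u" "Q u \<le> w"
    using Q_mono[OF ends_in_per_interval(1) u] Q_mono[OF u ends_in_per_interval(2)] v_le_Q Q_le_w
    by auto
  then show ?thesis
    using u by (auto simp: per_interval_def Q_def intro: per_sol_C_per Nem_C_per)
qed

lemma funpow_Q_in_per_interval: "u \<in> per_interval \<Longrightarrow> (Q ^^ n) u \<in> per_interval"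
  by (induction n) (auto intro: Q_in_per_interval)

lemma funpow_Q_mono:
  "x \<in> per_interval \<Longrightarrow> y \<in> per_interval \<Longrightarrow> x \<le> y \<Longrightarrow> (Q ^^ n) x \<le> (Q ^^ n) y"
  by (induction n) (auto intro: Q_mono funpow_Q_in_per_interval)

section \<open>Monotone iterates and their limits\<close>

lemma incseq_funpow_Q: "incseq (\<lambda>n. (Q ^^ n) v)"
proof (rule incseq_SucI)
  show "(Q ^^ n) v \<le> (Q ^^ Suc n) v" for n
    using funpow_Q_mono[OF ends_in_per_interval(1) Q_in_per_interval[OF ends_in_per_interval(1)] v_le_Q]
    by (simp add: funpow_swap1)
qed

lemma decseq_funpow_Q: "decseq (\<lambda>n. (Q ^^ n) w)"
proof (rule decseq_SucI)
  show "(Q ^^ Suc n) w \<le> (Q ^^ n) w" for n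
    using funpow_Q_mono[OF Q_in_per_interval[OF ends_in_per_interval(2)] ends_in_per_interval(2) Q_le_w]
    by (simp add: funpow_swap1)
qed

text \<open>Normality makes order intervals bounded in norm: \<open>y - p t\<close> lies between 0
  and \<open>q t - p t\<close>.\<close>

lemma bounded_between:
  fixes p q :: "real \<Rightarrow> 'a"
  assumes p: "p \<in> C_per \<omega>" and q: "q \<in> C_per \<omega>"
  obtains B where "0 \<le> B" "\<And>y t. p t \<le> y \<Longrightarrow> y \<le> q t \<Longrightarrow> norm y \<le> B"
proof -
  obtain B where B: "0 \<le> B" "\<And>t. norm (p t) \<le> B"
    using C_per_bounded[OF p period_pos] by metis
  obtain B' where B': "0 \<le> B'" "\<And>t. norm (q t - p t) \<le> B'"
    using C_per_bounded[OF C_per_diff[OF q p] period_pos] by metis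
  show ?thesis
  proof (rule that[of "B + N * B'"])
    fix y t assume y: "p t \<le> y" "y \<le> q t"
    have "norm y \<le> norm (p t) + norm (y - p t)"
      using norm_triangle_ineq[of "p t" "y - p t"] by simp
    also have "norm (y - p t) \<le> N * norm (q t - p t)"
      using y by (intro normal) auto
    also have "\<dots> \<le> N * B'"
      by (intro mult_left_mono B' N_nonneg)
    finally show "norm y \<le> B + N * B'"
      using B(2)[of t] by simp
  qed (use B B' N_nonneg in simp)
qed

lemma iterates_relatively_compact:
  assumes x: "\<And>n. x n \<in> per_interval" and Suc: "\<And>n. x (Suc n) = Q (x n)"
    and mono: "incseq x \<or> decseq x"
  shows "kuratowski (range (\<lambda>n. x n t)) \<le> 0"
proof -
  obtain B where B: "0 \<le> B" "\<And>y t. v t \<le> y \<Longrightarrow> y \<le> w t \<Longrightarrow> norm y \<le> B"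
    using bounded_between[OF v_per w_per] by metis
  \<comment> \<open>Continuity alone would not bound \<open>g\<close> on bounded sets; monotonicity
    encloses its values along the iterates between those along \<open>v\<close> and
    \<open>w\<close>.\<close>
  obtain B' where B': "0 \<le> B'" "\<And>y t. Nem v t \<le> y \<Longrightarrow> y \<le> Nem w t \<Longrightarrow> norm y \<le> B'"
    using bounded_between[OF Nem_C_per[OF v_per] Nem_C_per[OF w_per]] by metis
  have xB: "norm (x n t) \<le> B" for n t
    by (rule B(2)[OF per_intervalD(2,3)[OF x]])
  have "v \<le> x n" "x n \<le> w" for n
    using x[of n] by (auto simp: per_interval_def)
  then have NB: "norm (Nem (x n) t) \<le> B'" for n t
    by (intro B'(2)[of t] Nem_mono x ends_in_per_interval)
  have order: "x n \<in> order_interval v w" for n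
    using per_intervalD[OF x[of n]] by (simp add: order_interval_def C_per_continuous)
  define k where "k t = kuratowski (range (\<lambda>n. x n t))" for t
  have k_bdd: "bdd_above (range k)"
    unfolding k_def using xB B(1) by (intro bdd_aboveI[of _ "2 * B"]) (auto intro!: kuratowski_bound)
  define \<Phi> where "\<Phi> = (SUP t. k t)"
  have k_le: "k t \<le> \<Phi>" for t
    unfolding \<Phi>_def by (intro cSUP_upper k_bdd) auto
  have bdd: "bounded (range (\<lambda>n. x n t))" for t
    unfolding bounded_iff using xB by blast
  have "0 \<le> k 0"
    unfolding k_def by (rule kuratowski_nonneg[OF bdd])
  then have \<Phi>0: "0 \<le> \<Phi>" using k_le[of 0] by linarith
  have step: "k t \<le> c * (4 * \<omega> * norm R * M) * \<Phi>" for t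
  proof -
    define J where "J n = integral {t - \<omega>..t} (\<lambda>s. T (t - s) (Nem (x n) s))" for n
    have J_cont: "continuous_on {t - \<omega>..t} (\<lambda>s. T (t - s) (Nem (x n) s))" for n
      by (intro continuous_on_conv C_per_continuous[OF Nem_C_per] per_intervalD(1)[OF x] order_refl)
    have TB: "norm (T (t - s) (Nem (x n) s)) \<le> M * B'" if "s \<in> {t - \<omega>..t}" for n s
      using norm_apply_le[of "t - s" "Nem (x n) s"] that mult_left_mono[OF NB[of n s] M_nonneg] by simp
    \<comment> \<open>The inner factor 2 adds the orbits at \<open>s\<close> and at
      \<open>s - \<tau>\<close>, each at most \<open>\<Phi>\<close>; the outer one is that of the
      integral inequality.\<close>
    have "kuratowski (range J) \<le> 2 * (t - (t - \<omega>)) * (M * (c * (2 * \<Phi>)))"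
      unfolding J_def
    proof (rule kuratowski_integral_le[OF _ J_cont TB])
      fix s assume s: "s \<in> {t - \<omega>..t}"
      have bddN: "bounded (range (\<lambda>n. Nem (x n) s))"
        unfolding bounded_iff using NB by blast
      have "kuratowski (range (\<lambda>n. T (t - s) (Nem (x n) s)))
          = kuratowski (T (t - s) ` range (\<lambda>n. Nem (x n) s))"
        by (simp add: image_image)
      also have "\<dots> \<le> M * kuratowski (range (\<lambda>n. Nem (x n) s))"
        using s by (intro kuratowski_blinfun_image_le bddN norm_le) auto
      also have "kuratowski (range (\<lambda>n. Nem (x n) s)) \<le> c * (k s + k (s - \<tau>))"
        unfolding Nem_def k_def by (rule g_kuratowski[OF order mono])
      also have "\<dots> \<le> c * (2 * \<Phi>)"
        using k_le[of s] k_le[of "s - \<tau>"] c_nonneg by (intro mult_left_mono) auto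
      finally show "kuratowski (range (\<lambda>n. T (t - s) (Nem (x n) s))) \<le> M * (c * (2 * \<Phi>))"
        using M_nonneg by (simp add: mult_left_mono)
    qed (use period_pos in auto)
    then have J: "kuratowski (range J) \<le> 2 * \<omega> * (M * (c * (2 * \<Phi>)))" by simp
    have J_bdd: "bounded (range J)"
      unfolding bounded_iff
    proof (intro exI[of _ "M * B' * (t - (t - \<omega>))"] ballI, clarify)
      show "norm (J n) \<le> M * B' * (t - (t - \<omega>))" for n
        unfolding J_def using period_pos by (intro integral_bound J_cont TB) auto
    qed
    have "range (\<lambda>n. x n t) = insert (x 0 t) (range (\<lambda>n. x (Suc n) t))"
      by (subst UNIV_nat_eq) (simp add: image_image)
    then have "k t \<le> kuratowski (range (\<lambda>n. x (Suc n) t))"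
      unfolding k_def using bdd[of t] by (auto intro!: kuratowski_insert_le elim!: bounded_subset)
    also have "range (\<lambda>n. x (Suc n) t) = R ` range J"
      by (simp add: image_image Suc Q_def per_sol_def J_def)
    also have "kuratowski \<dots> \<le> norm R * kuratowski (range J)"
      by (rule kuratowski_blinfun_image_le[OF J_bdd order_refl])
    also have "\<dots> \<le> norm R * (2 * \<omega> * (M * (c * (2 * \<Phi>))))"
      by (intro mult_left_mono J) simp
    finally show ?thesis by (simp add: mult_ac)
  qed
  have "\<Phi> \<le> c * (4 * \<omega> * norm R * M) * \<Phi>"
    unfolding \<Phi>_def by (intro cSUP_least) (use step in \<open>auto simp: \<Phi>_def\<close>)
  then have "\<Phi> \<le> 0"
    using c_small \<Phi>0 by (metis less_le_not_le mult_less_cancel_right2 not_le)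
  then show ?thesis
    using k_le[of t] by (simp add: k_def)
qed

text \<open>Vector-valued dominated convergence is not needed: it is applied to the norms of the
  differences of the integrands only, which makes the iterates uniformly Cauchy and hence
  their pointwise limit continuous.\<close>

lemma iterates_converge:
  assumes x: "\<And>n. x n \<in> per_interval" and Suc: "\<And>n. x (Suc n) = Q (x n)"
    and mono: "incseq x \<or> decseq x"
  obtains u where "converges_in_C_per \<omega> x u" "\<And>t. (\<lambda>n. x n t) \<longlonglongrightarrow> u t" "Q u = u"
proof -
  obtain B where B: "0 \<le> B" "\<And>y t. v t \<le> y \<Longrightarrow> y \<le> w t \<Longrightarrow> norm y \<le> B"
    using bounded_between[OF v_per w_per] by metis
  obtain B' where B': "0 \<le> B'" "\<And>y t. Nem v t \<le> y \<Longrightarrow> y \<le> Nem w t \<Longrightarrow> norm y \<le> B'"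
    using bounded_between[OF Nem_C_per[OF v_per] Nem_C_per[OF w_per]] by metis
  have "v \<le> x n" "x n \<le> w" for n
    using x[of n] by (auto simp: per_interval_def)
  then have NB: "norm (Nem (x n) t) \<le> B'" for n t
    by (intro B'(2)[of t] Nem_mono x ends_in_per_interval)
  have x_per: "x n \<in> C_per \<omega>" for n
    by (rule per_intervalD(1)[OF x])
  have Nx_per: "Nem (x n) \<in> C_per \<omega>" for n
    by (rule Nem_C_per[OF x_per])
  have "Cauchy (\<lambda>n. x n t)" for t
  proof (rule monotone_Cauchy[OF normal N_nonneg])
    show "incseq (\<lambda>n. x n t) \<or> decseq (\<lambda>n. x n t)"
      by (rule disj_forward[OF mono]) (simp_all add: monotone_def le_fun_def)
    show "bounded (range (\<lambda>n. x n t))"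
      unfolding bounded_iff using B(2) per_intervalD[OF x] by blast
    show "kuratowski (range (\<lambda>n. x n t)) \<le> 0"
      by (rule iterates_relatively_compact[OF x Suc mono])
  qed
  then have "\<exists>u. \<forall>t. (\<lambda>n. x n t) \<longlonglongrightarrow> u t"
    by (intro choice) (simp add: Cauchy_convergent_iff convergent_def)
  then obtain u where u: "\<And>t. (\<lambda>n. x n t) \<longlonglongrightarrow> u t" by blast
  have N_lim: "(\<lambda>n. Nem (x n) s) \<longlonglongrightarrow> Nem u s" for s
    by (rule Nem_tendsto[OF u])
  \<comment> \<open>This is the integral that dominates the distance between the next iterates in
    \<open>per_sol_dist\<close>.\<close>
  define d where "d n m = integral {- \<omega>..\<omega>} (\<lambda>s. norm (Nem (x n) s - Nem (x m) s))" for n m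
  have Cauchy: "\<exists>k. \<forall>n\<ge>k. \<forall>m\<ge>k. d n m < e" if e: "e > 0" for e
  proof (rule ccontr)
    assume "\<not> ?thesis"
    \<comment> \<open>Failure of the Cauchy property yields index sequences tending to infinity
      along which \<open>d\<close> stays above \<open>e\<close>; dominated convergence along them
      gives the contradiction.\<close>
    then have "\<forall>k. \<exists>n m. k \<le> n \<and> k \<le> m \<and> e \<le> d n m"
      unfolding not_ex not_all not_imp not_less by blast
    then obtain a b where ab: "\<And>k. k \<le> a k" "\<And>k. k \<le> b k" "\<And>k. e \<le> d (a k) (b k)"
      by metis
    then have lims: "filterlim a at_top sequentially" "filterlim b at_top sequentially"
      by (auto intro: filterlim_at_top_mono[OF filterlim_ident])
    have "(\<lambda>k. d (a k) (b k)) \<longlonglongrightarrow> 0"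
      unfolding d_def
    proof (rule integral_norm_tendsto_zero)
      show "continuous_on {- \<omega>..\<omega>} (\<lambda>s. Nem (x (a k)) s - Nem (x (b k)) s)" for k
        by (intro continuous_intros C_per_continuous[OF Nx_per])
      show "norm (Nem (x (a k)) s - Nem (x (b k)) s) \<le> 2 * B'" for k s
        using norm_triangle_ineq4[of "Nem (x (a k)) s" "Nem (x (b k)) s"] NB[of "a k" s] NB[of "b k" s]
        by simp
      show "(\<lambda>k. Nem (x (a k)) s - Nem (x (b k)) s) \<longlonglongrightarrow> 0" for s
        using tendsto_diff[OF filterlim_compose[OF N_lim[of s] lims(1)] filterlim_compose[OF N_lim[of s] lims(2)]]
        by simp
    qed
    from order_tendstoD(2)[OF this e] obtain k where "d (a k) (b k) < e"
      unfolding eventually_sequentially by blast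
    with ab(3)[of k] show False by simp
  qed
  have uniform: "\<exists>k. \<forall>n\<ge>k. \<forall>t. norm (x n t - u t) \<le> e" if e: "e > 0" for e
  proof -
    have K: "0 \<le> norm R * M" using M_nonneg by simp
    define r where "r = e / (norm R * M + 1)"
    have r: "r > 0" "norm R * M * r \<le> e" using e K by (auto simp: r_def field_simps)
    obtain k where k: "\<And>n m. k \<le> n \<Longrightarrow> k \<le> m \<Longrightarrow> d n m < r"
      using Cauchy[OF r(1)] by blast
    have "norm (x n t - u t) \<le> e" if n: "Suc k \<le> n" for n t
    \<comment> \<open>Letting \<open>m\<close> tend to infinity turns the uniform Cauchy estimate
      into a uniform distance to the pointwise limit.\<close>
    proof (rule tendsto_upperbound)
      show "(\<lambda>m. norm (x n t - x m t)) \<longlonglongrightarrow> norm (x n t - u t)"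
        by (intro tendsto_intros u)
      show "\<forall>\<^sub>F m in sequentially. norm (x n t - x m t) \<le> e"
        using eventually_ge_at_top[of "Suc k"]
      proof eventually_elim
        case (elim m)
        obtain n' m' where nm: "n = Suc n'" "m = Suc m'" "k \<le> n'" "k \<le> m'"
          using n elim by (metis Suc_le_D Suc_le_mono)
        have "norm (x n t - x m t) \<le> norm R * M * d n' m'"
          unfolding nm Suc Q_def d_def by (rule per_sol_dist[OF Nx_per Nx_per])
        also have "\<dots> \<le> norm R * M * r"
          using k[OF nm(3,4)] K by (intro mult_left_mono) auto
        finally show ?case using r(2) by simp
      qed
    qed simp
    then show ?thesis by blast
  qed
  have "uniform_limit UNIV x u sequentially"
    unfolding uniform_limit_iff eventually_sequentially
  proof (intro allI impI)
    fix e :: real assume "e > 0"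
    with uniform[of "e / 2"] obtain k where "\<And>n t. k \<le> n \<Longrightarrow> norm (x n t - u t) \<le> e / 2" by auto
    moreover have "e / 2 < e" using \<open>e > 0\<close> by simp
    ultimately show "\<exists>k. \<forall>n\<ge>k. \<forall>t\<in>UNIV. dist (x n t) (u t) < e"
      unfolding dist_norm by (meson order_le_less_trans)
  qed
  then have "continuous_on UNIV u"
    by (rule uniform_limit_theorem[rotated]) (auto simp: C_per_continuous[OF x_per])
  moreover have "u (t + \<omega>) = u t" for t
    using u[of "t + \<omega>"] u[of t] x_per by (simp add: C_per_def LIMSEQ_unique)
  ultimately have u_per: "u \<in> C_per \<omega>" by (simp add: C_per_def)
  have "(\<lambda>n. C_per_norm \<omega> (\<lambda>t. x n t - u t)) \<longlonglongrightarrow> 0"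
  proof (rule LIMSEQ_I)
    fix e :: real assume e: "e > 0"
    with uniform[of "e / 2"] obtain k where k: "\<And>n t. k \<le> n \<Longrightarrow> norm (x n t - u t) \<le> e / 2" by auto
    have "norm (C_per_norm \<omega> (\<lambda>t. x n t - u t) - 0) < e" if n: "k \<le> n" for n
    proof -
      have "C_per_norm \<omega> (\<lambda>t. x n t - u t) \<le> e / 2"
        unfolding C_per_norm_def using period_pos k[OF n] by (intro cSUP_least) auto
      moreover have "norm (x n 0 - u 0) \<le> C_per_norm \<omega> (\<lambda>t. x n t - u t)"
        unfolding C_per_norm_def using period_pos k[OF n]
        by (intro cSUP_upper bdd_aboveI[of _ "e / 2"]) auto
      then have "0 \<le> C_per_norm \<omega> (\<lambda>t. x n t - u t)"
        using norm_ge_zero order_trans by blast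
      ultimately show ?thesis using e by simp
    qed
    then show "\<exists>k. \<forall>n\<ge>k. norm (C_per_norm \<omega> (\<lambda>t. x n t - u t) - 0) < e" by blast
  qed
  then have conv: "converges_in_C_per \<omega> x u"
    using x_per u_per by (simp add: converges_in_C_per_def)
  have "Q u = u"
  proof
    fix t
    have "(\<lambda>n. integral {- \<omega>..\<omega>} (\<lambda>s. norm (Nem (x n) s - Nem u s))) \<longlonglongrightarrow> 0"
    proof (rule integral_norm_tendsto_zero)
      show "continuous_on {- \<omega>..\<omega>} (\<lambda>s. Nem (x n) s - Nem u s)" for n
        by (intro continuous_intros C_per_continuous[OF Nx_per] C_per_continuous[OF Nem_C_per[OF u_per]])
      have "norm (Nem u s) \<le> B'" for s
        by (rule tendsto_upperbound[OF tendsto_norm[OF N_lim]]) (use NB in auto)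
      then show "norm (Nem (x n) s - Nem u s) \<le> 2 * B'" for n s
        using norm_triangle_ineq4[of "Nem (x n) s" "Nem u s"] add_mono[OF NB[of n s], of "norm (Nem u s)" B']
        by fastforce
      show "(\<lambda>n. Nem (x n) s - Nem u s) \<longlonglongrightarrow> 0" for s
        using N_lim by (rule LIM_zero)
    qed
    then have "(\<lambda>n. norm R * M * integral {- \<omega>..\<omega>} (\<lambda>s. norm (Nem (x n) s - Nem u s))) \<longlonglongrightarrow> norm R * M * 0"
      by (intro tendsto_intros)
    then have "(\<lambda>n. x (Suc n) t - Q u t) \<longlonglongrightarrow> 0"
      unfolding Suc Q_def mult_zero_right
      by (rule Lim_null_comparison[rotated])
         (auto intro!: always_eventually per_sol_dist Nx_per Nem_C_per u_per)
    then have "(\<lambda>n. x (Suc n) t) \<longlonglongrightarrow> Q u t"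
      by (rule LIM_zero_cancel)
    moreover have "(\<lambda>n. x (Suc n) t) \<longlonglongrightarrow> u t"
      by (rule LIMSEQ_Suc[OF u])
    ultimately show "Q u t = u t" by (rule LIMSEQ_unique)
  qed
  with conv u that show ?thesis by blast
qed

text \<open>A fixed point between \<open>v\<close> and \<open>w\<close> is reproduced by every power
  of \<open>Q\<close>, so it stays between the iterates of \<open>v\<close> and of \<open>w\<close>;
  the closed cone carries this to the limits.\<close>

lemma extremal_fixed_points:
  obtains u_min u_max where
    "u_min \<in> per_interval" "u_max \<in> per_interval" "Q u_min = u_min" "Q u_max = u_max" "u_min \<le> u_max"
    "\<And>u. u \<in> per_interval \<Longrightarrow> Q u = u \<Longrightarrow> u_min \<le> u \<and> u \<le> u_max"
    "converges_in_C_per \<omega> (\<lambda>n. (Q ^^ n) v) u_min"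
    "converges_in_C_per \<omega> (\<lambda>n. (Q ^^ n) w) u_max"
proof -
  note iter = funpow_Q_in_per_interval
  have "v \<le> w" using v_le_w by (simp add: le_fun_def)
  then have le: "(Q ^^ n) v \<le> (Q ^^ n) w" for n
    by (intro funpow_Q_mono ends_in_per_interval)
  obtain u_min where lo: "converges_in_C_per \<omega> (\<lambda>n. (Q ^^ n) v) u_min"
    "\<And>t. (\<lambda>n. (Q ^^ n) v t) \<longlonglongrightarrow> u_min t" "Q u_min = u_min"
    by (rule iterates_converge[of "\<lambda>n. (Q ^^ n) v"])
       (use iter ends_in_per_interval incseq_funpow_Q in auto)
  obtain u_max where hi: "converges_in_C_per \<omega> (\<lambda>n. (Q ^^ n) w) u_max"
    "\<And>t. (\<lambda>n. (Q ^^ n) w t) \<longlonglongrightarrow> u_max t" "Q u_max = u_max"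
    by (rule iterates_converge[of "\<lambda>n. (Q ^^ n) w"])
       (use iter ends_in_per_interval decseq_funpow_Q in auto)
  have lim_le: "a \<le> b"
    if "\<And>t. (\<lambda>n. p n t) \<longlonglongrightarrow> a t" "\<And>t. (\<lambda>n. q n t) \<longlonglongrightarrow> b t" "\<And>n. p n \<le> q n"
    for a b and p q :: "nat \<Rightarrow> real \<Rightarrow> 'a"
    using that(3)
    by (intro le_funI tendsto_le_ordered_banach[OF that(1,2)]) (auto simp: le_fun_def)
  note lim_ge_const = lim_le[of "\<lambda>_. z" z for z, OF tendsto_const]
    and lim_le_const = lim_le[of _ _ "\<lambda>_. z" z for z, OF _ tendsto_const]
  have lo_mem: "u_min \<in> per_interval" and hi_mem: "u_max \<in> per_interval"
    using lo(1) hi(1) iter[OF ends_in_per_interval(1)] iter[OF ends_in_per_interval(2)]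
    by (auto simp: per_interval_def converges_in_C_per_def
        intro: lim_ge_const[OF lo(2)] lim_le_const[OF lo(2)] lim_ge_const[OF hi(2)] lim_le_const[OF hi(2)])
  have "u_min \<le> u_max"
    by (rule lim_le[OF lo(2) hi(2) le])
  moreover have "u_min \<le> u \<and> u \<le> u_max" if u: "u \<in> per_interval" "Q u = u" for u
  proof -
    have fixed: "(Q ^^ n) u = u" for n
      by (induction n) (simp_all add: u(2))
    have "v \<le> u" "u \<le> w" using u(1) by (auto simp: per_interval_def)
    then have "(Q ^^ n) v \<le> u" "u \<le> (Q ^^ n) w" for n
      using funpow_Q_mono[OF ends_in_per_interval(1) u(1), of n]
        funpow_Q_mono[OF u(1) ends_in_per_interval(2), of n] by (simp_all add: fixed)
    then show ?thesis
      by (auto intro: lim_le_const[OF lo(2)] lim_ge_const[OF hi(2)])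
  qed
  ultimately show ?thesis
    using that lo hi lo_mem hi_mem by blast
qed

end

section \<open>Translation of the delayed equation into the fixed point problem\<close>

theorem theorem3p2:
  fixes A :: "'a::ordered_banach \<Rightarrow> 'a" and D :: "'a set"
    and T :: "real \<Rightarrow> 'a \<Rightarrow>\<^sub>L 'a"
    and F :: "real \<Rightarrow> 'a \<Rightarrow> 'a \<Rightarrow> 'a"
    and v0 w0 :: "real \<Rightarrow> 'a"
    and \<omega> \<tau> C c :: real
  assumes normal: "normal_cone TYPE('a)"
    and "\<omega> > 0" and "\<tau> > 0"
    and A: "closed_linear_op D A"
    and T: "C0_semigroup T" "generator_of D (\<lambda>x. - A x) T"
      "positive_semigroup T" "equicontinuous_semigroup T"
    and F_cont: "continuous_on UNIV (\<lambda>(t, x, y). F t x y)"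
    and F_per: "\<And>t x y. F (t + \<omega>) x y = F t x y"
    and v0: "lower_solution \<omega> \<tau> D A F v0"
    and w0: "upper_solution \<omega> \<tau> D A F w0"
    and "v0 \<le> w0"
    and "C \<ge> 0"
    and i: "\<And>t x1 x2 y1 y2.
      v0 t \<le> x1 \<Longrightarrow> x1 \<le> x2 \<Longrightarrow> x2 \<le> w0 t \<Longrightarrow>
      v0 (t - \<tau>) \<le> y1 \<Longrightarrow> y1 \<le> y2 \<Longrightarrow> y2 \<le> w0 (t - \<tau>) \<Longrightarrow>
      F t x2 y2 - F t x1 y1 \<ge> - C *\<^sub>R (x2 - x1)"
    \<comment> \<open>The constants \<open>C_S\<close> and \<open>M_S\<close> are well defined.\<close>
    and inv: "blinfun_invertible (id_blinfun - shifted_semigroup C T \<omega>)"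
    and bdd: "bdd_above ((\<lambda>t. norm (shifted_semigroup C T t)) ` {0..})"
    \<comment> \<open>\<open>c < 1 / (4 \<omega> C_S M_S)\<close>, multiplied out so that it also reads correctly for \<open>E = {0}\<close>,
      where \<open>C_S = M_S = 0\<close>.\<close>
    and c: "0 \<le> c"
      "c * (4 * \<omega> * C_S \<omega> (shifted_semigroup C T) * M_S (shifted_semigroup C T)) < 1"
    and ii: "\<And>t u. (\<And>n. u n \<in> order_interval v0 w0) \<Longrightarrow> incseq u \<or> decseq u \<Longrightarrow>
      kuratowski (range (\<lambda>n::nat. F t (u n t) (u n (t - \<tau>)) + C *\<^sub>R u n t))
        \<le> c * (kuratowski (range (\<lambda>n. u n t)) + kuratowski (range (\<lambda>n. u n (t - \<tau>))))"
  shows "\<exists>u_min u_max.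
      mild_solution \<omega> \<tau> T F u_min \<and> mild_solution \<omega> \<tau> T F u_max
    \<and> v0 \<le> u_min \<and> u_min \<le> u_max \<and> u_max \<le> w0
    \<and> (\<forall>u. mild_solution \<omega> \<tau> T F u \<and> v0 \<le> u \<and> u \<le> w0 \<longrightarrow> u_min \<le> u \<and> u \<le> u_max)
    \<and> incseq (\<lambda>i. (iter_op \<omega> \<tau> C T F ^^ i) v0)
    \<and> decseq (\<lambda>i. (iter_op \<omega> \<tau> C T F ^^ i) w0)
    \<and> (\<forall>i. (iter_op \<omega> \<tau> C T F ^^ i) v0 \<le> (iter_op \<omega> \<tau> C T F ^^ i) w0)
    \<and> converges_in_C_per \<omega> (\<lambda>i. (iter_op \<omega> \<tau> C T F ^^ i) v0) u_min
    \<and> converges_in_C_per \<omega> (\<lambda>i. (iter_op \<omega> \<tau> C T F ^^ i) w0) u_max"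
proof -
  let ?S = "shifted_semigroup C T"
  define R where "R = blinfun_inv (id_blinfun - ?S \<omega>)"
  define M where "M = M_S ?S"
  have S_le: "norm (?S t) \<le> M" if "0 \<le> t" for t
    unfolding M_def M_S_def using that bdd by (intro cSUP_upper) auto
  interpret T: C0_semigroup_growth T M C
  proof
    fix t :: real assume "0 \<le> t"
    have "norm (T t) = norm (?S t) * exp (C * t)"
      by (simp add: shifted_semigroup_def flip: exp_add)
    also have "\<dots> \<le> M * exp (C * t)"
      using S_le[OF \<open>0 \<le> t\<close>] by (intro mult_right_mono) auto
    finally show "norm (T t) \<le> M * exp (C * t)" .
  qed (fact T(1))
  interpret S: positive_periodic_semigroup ?S M \<omega> R
  proof (intro positive_periodic_semigroup.intro positive_periodic_semigroup_axioms.intro)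
    show "C0_semigroup_growth ?S M 0"
      using T.shifted_C0_semigroup_growth[of C] by simp
    show "is_blinfun_inverse (id_blinfun - ?S \<omega>) R"
      unfolding R_def by (rule is_blinfun_inverse_blinfun_inv[OF inv])
    show "positive_semigroup ?S"
      using T(3) by (auto simp: positive_semigroup_def shifted_semigroup_def blinfun.scaleR_left
          intro!: scaleR_nonneg_nonneg)
  qed fact
  define g where "g t x y = F t x y + C *\<^sub>R x" for t x y
  have g_cont: "continuous_on UNIV (\<lambda>(t, x, y). g t x y)"
    unfolding g_def using F_cont by (auto simp: case_prod_unfold intro!: continuous_intros)
  have per: "v0 \<in> C_per \<omega>" "w0 \<in> C_per \<omega>"
    using v0 w0 by (auto simp: lower_solution_def upper_solution_def C1_per_def)
  have g_u_cont: "continuous_on UNIV (\<lambda>s. g s (u s) (u (s - \<tau>)))" if u: "u \<in> C_per \<omega>" for u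
    by (rule continuous_on_delayed[OF g_cont C_per_continuous[OF u]])
  \<comment> \<open>These identities supply \<open>v_sub\<close> and \<open>w_super\<close>:
    \<open>z\<close> is the periodic solution for its own right-hand side, and the differential
    inequality compares that side with \<open>g\<close> along \<open>z\<close>.\<close>
  have classical: "continuous_on UNIV (\<lambda>t. vector_derivative z (at t) + A (z t) + C *\<^sub>R z t)"
    "S.per_sol (\<lambda>t. vector_derivative z (at t) + A (z t) + C *\<^sub>R z t) = z"
    if z: "z \<in> C1_per \<omega> \<inter> C_per_graph \<omega> D A" for z
  proof -
    have z_per: "z \<in> C_per \<omega>" and C1: "z C1_differentiable_on UNIV"
      using z by (auto simp: C1_per_def)
    then have z_cont: "continuous_on UNIV z" by (intro C_per_continuous)
    have cont: "continuous_on UNIV (\<lambda>t. vector_derivative z (at t) + A (z t))"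
    proof (rule continuous_on_add)
      show "continuous_on UNIV (\<lambda>t. vector_derivative z (at t))"
        using C1 by (simp add: C1_differentiable_on_eq)
      show "continuous_on UNIV (\<lambda>t. A (z t))"
        using z by (intro C_per_graph_continuous[OF A, of z \<omega>]) simp
    qed
    show "continuous_on UNIV (\<lambda>t. vector_derivative z (at t) + A (z t) + C *\<^sub>R z t)"
      by (rule continuous_on_add[OF cont]) (intro continuous_intros z_cont)
    have "T.mild (\<lambda>t. vector_derivative z (at t) + A (z t)) z"
    proof (rule T.mild_of_classical[OF T(2) _ _ cont])
      show "z t \<in> D" for t using z by (auto simp: C_per_graph_def)
      show "(z has_vector_derivative vector_derivative z (at t)) (at t)" for t
        using C1 by (simp add: C1_differentiable_on_eq vector_derivative_works)
    qed
    then show "S.per_sol (\<lambda>t. vector_derivative z (at t) + A (z t) + C *\<^sub>R z t) = z"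
      by (intro S.per_sol_of_mild z_per T.mild_shifted z_cont cont)
  qed
  obtain N where N: "\<And>x y::'a. 0 \<le> x \<Longrightarrow> x \<le> y \<Longrightarrow> norm x \<le> N * norm y"
    using normal unfolding normal_cone_def by blast
  \<comment> \<open>The definition of \<open>normal_cone\<close> leaves the sign of \<open>N\<close>
    open, hence \<open>max N 0\<close>.\<close>
  interpret monotone_delay_iteration ?S M \<omega> R \<tau> c "max N 0" g v0 w0
  proof
    show "norm x \<le> max N 0 * norm y" if "0 \<le> x" "x \<le> y" for x y :: 'a
      using N[OF that] mult_right_mono[of N "max N 0" "norm y"] by simp
    show "g t x1 y1 \<le> g t x2 y2"
      if "v0 t \<le> x1" "x1 \<le> x2" "x2 \<le> w0 t" "v0 (t - \<tau>) \<le> y1" "y1 \<le> y2" "y2 \<le> w0 (t - \<tau>)"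
      for t x1 x2 y1 y2
      using i[OF that] by (simp add: g_def algebra_simps)
    have v0': "v0 \<in> C1_per \<omega> \<inter> C_per_graph \<omega> D A" and w0': "w0 \<in> C1_per \<omega> \<inter> C_per_graph \<omega> D A"
      using v0 w0 by (auto simp: lower_solution_def upper_solution_def)
    show "v0 t \<le> S.per_sol (\<lambda>s. g s (v0 s) (v0 (s - \<tau>))) t" for t
      using S.per_sol_mono[OF classical(1)[OF v0'] g_u_cont[OF per(1)], of t] v0 classical(2)[OF v0']
      by (simp add: lower_solution_def g_def)
    show "S.per_sol (\<lambda>s. g s (w0 s) (w0 (s - \<tau>))) t \<le> w0 t" for t
      using S.per_sol_mono[OF g_u_cont[OF per(2)] classical(1)[OF w0'], of t] w0 classical(2)[OF w0']
      by (simp add: upper_solution_def g_def)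
    show "c * (4 * \<omega> * norm R * M) < 1"
      using c(2) by (simp add: R_def M_def C_S_def)
    show "kuratowski (range (\<lambda>n. g t (u n t) (u n (t - \<tau>))))
        \<le> c * (kuratowski (range (\<lambda>n. u n t)) + kuratowski (range (\<lambda>n. u n (t - \<tau>))))"
      if "\<And>n. u n \<in> order_interval v0 w0" "incseq u \<or> decseq u" for t u
      unfolding g_def using ii[OF that] .
    show "v0 t \<le> w0 t" for t
      using \<open>v0 \<le> w0\<close> by (simp add: le_fun_def)
  qed (use g_cont per c(1) in \<open>auto simp: g_def F_per\<close>)
  have iter_op: "iter_op \<omega> \<tau> C T F = Q"
    by (intro ext) (simp add: iter_op_def Let_def Q_def S.per_sol_def Nem_def g_def flip: R_def)
  have mild_iff: "mild_solution \<omega> \<tau> T F u \<longleftrightarrow> Q u = u" if u: "u \<in> C_per \<omega>" for u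
  proof -
    have F_u_cont: "continuous_on UNIV (\<lambda>s. F s (u s) (u (s - \<tau>)))"
      using continuous_on_diff[OF g_u_cont[OF u] continuous_on_scaleR[OF continuous_on_const C_per_continuous[OF u]], of C]
      by (simp add: g_def)
    have "mild_solution \<omega> \<tau> T F u \<longleftrightarrow> T.mild (\<lambda>s. F s (u s) (u (s - \<tau>))) u"
      using u by (simp add: mild_solution_def T.mild_def)
    also have "\<dots> \<longleftrightarrow> S.mild (Nem u) u"
      unfolding Nem_def[abs_def] g_def
      by (rule T.mild_shifted_iff[OF C_per_continuous[OF u] F_u_cont, symmetric])
    also have "\<dots> \<longleftrightarrow> Q u = u"
      unfolding Q_def by (rule S.per_sol_eq_iff_mild[OF u Nem_C_per[OF u], symmetric])
    finally show ?thesis .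
  qed
  from extremal_fixed_points obtain u_min u_max where u:
    "u_min \<in> per_interval" "u_max \<in> per_interval" "Q u_min = u_min" "Q u_max = u_max" "u_min \<le> u_max"
    "\<And>u. u \<in> per_interval \<Longrightarrow> Q u = u \<Longrightarrow> u_min \<le> u \<and> u \<le> u_max"
    "converges_in_C_per \<omega> (\<lambda>n. (Q ^^ n) v0) u_min"
    "converges_in_C_per \<omega> (\<lambda>n. (Q ^^ n) w0) u_max" by blast
  have extremal: "u_min \<le> u \<and> u \<le> u_max" if "mild_solution \<omega> \<tau> T F u \<and> v0 \<le> u \<and> u \<le> w0" for u
  proof -
    have u_per: "u \<in> C_per \<omega>" using that by (simp add: mild_solution_def)
    then show ?thesis
      using that mild_iff[OF u_per] by (intro u(6)) (auto simp: per_interval_def)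
  qed
  have le: "(Q ^^ n) v0 \<le> (Q ^^ n) w0" for n
    by (intro funpow_Q_mono ends_in_per_interval) fact
  show ?thesis
    unfolding iter_op
    using u extremal le incseq_funpow_Q decseq_funpow_Q mild_iff
    by (intro exI[of _ u_min] exI[of _ u_max]) (auto simp: per_interval_def)
qed

end
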